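(* Let $(\Sigma,m)$ be a weighted simplicial complex which is locally balanced. Then the following are equivalent: (i) $\partial\partial_N=0$, i.e. $\partial(\partial_N\omega)=0$ for all $\omega\in D(\partial_N)$. (ii) For all $\rho\in\Sigma$, all connected components of the graph $b_\rho$ over $\mathrm{lk}(\rho)$ are recurrent.
   Context: Weighted simplicial complexes. Let $X$ be a set (of vertices). A simplicial complex $\hat\Sigma$ over $X$ is a (non-empty) set of finite subsets of $X$ closed under taking subsets, whose $0$-simplices are identified with $X$; it contains $\varnothing$. A simplex with $k+1$ elements has dimension $k$. Write $\tau\prec\sigma$ (or $\sigma\succ\tau$) if $\tau\subseteq\sigma$ and $|\sigma\setminus\tau|=1$; then $\tau$ is a face of $\sigma$ and $\sigma$ a coface of $\tau$. Let $m:\hat\Sigma\to(0,\infty)$. Put $\Sigma=\hat\Sigma$ if $\sum_{x\in X}m(x)<\infty$ and $\Sigma=\hat\Sigma\setminus\{\varnothing\}$ otherwise. Assume $m$ is locally summable: $\sum_{\sigma\succ\tau}m(\sigma)<\infty$ for all $\tau\in\Sigma$. Then $(\Sigma,m)$ is called a weighted simplicial complex; no local finiteness is assumed. All simplices below range over $\Sigma$. $C(\Sigma)$ denotes the complex functions on $\Sigma$ and $\ell^2=\ell^2(\Sigma,m)=\{\omega\in C(\Sigma):\sum_{\tau\in\Sigma} m(\tau)|\omega(\tau)|^2<\infty\}$. Coboundary and boundary. Fix a coboundary operator, i.e. a linear operator $\delta:C(\Sigma)\to C(\Sigma)$ of the form $\delta\omega(\sigma)=\sum_{\tau\prec\sigma}\theta(\tau,\sigma)\omega(\tau)$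 (a finite sum) with $\theta(\tau,\sigma)=\delta 1_\tau(\sigma)\in\{\pm1\}$ for $\tau\prec\sigma$, satisfying $\delta\delta=0$. The boundary operator $\partial:D(\partial)\to C(\Sigma)$ is $$\partial\omega(\rho)=\frac1{m(\rho)}\sum_{\tau\succ\rho}m(\tau)\theta(\rho,\tau)\omega(\tau),\qquad D(\partial)=\Big\{\omega\in C(\Sigma):\sum_{\tau\succ\rho}m(\tau)|\omega(\tau)|<\infty\text{ for all }\rho\in\Sigma\Big\}.$$ One has $\ell^2\subseteq D(\partial)$. The operator $\partial_N$ is the restriction of $\partial$ to $D(\partial_N)=\{\omega\in\ell^2:\partial\omega\in\ell^2\}$. Links. For $\rho\in\Sigma$, $\mathrm{lk}(\rho)=\{v\in X: v\cup\rho\in\Sigma,\ v\cup\rho\succ\rho\}$ (identifying the vertex $v$ with $\{v\}$), with $v\rho=v\cup\rho$ and $vv'\rho=v\cup v'\cup\rho$. The link graph is the symmetric function $b_\rho:\mathrm{lk}(\rho)\times\mathrm{lk}(\rho)\to[0,\infty)$, $b_\rho(v,v')=m(vv'\rho)$ if $v\ne v'$ and $vv'\rho\in\Sigma$, and $b_\rho(v,v')=0$ otherwise. Local summability gives $\sum_{v'}b_\rho(v,v')<\infty$ for all $v\in\mathrm{lk}(\rho)$. Connected components are the classes of vertices joined by finite paths along which $b_\rho>0$. Local balancedness. $(\Sigma,m)$ is locally balanced if for every $\rho\in\Sigma$ $$\sup\Big\{\frac{m(vv'\rho)}{m(vv'\rho\setminus w)}: v,v'\in\mathrm{lk}(\rho),\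 v\neq v',\ vv'\rho\in\Sigma,\ w\in\rho\Big\}<\infty,$$ where $vv'\rho\setminus w$ means $vv'\rho$ with the vertex $w$ removed and $\sup\varnothing=0$. Recurrence. A connected graph $b$ over $X$ is recurrent if the Markov chain $(Y_n)$ with transition probabilities $\mathbb P(Y_n=y\mid Y_{n-1}=x)=b(x,y)/\sum_z b(x,z)$ satisfies $\mathbb P(Y_k=y\text{ for some }k>0\mid Y_0=x)=1$ for all $x,y$; equivalently, the constant function $1$ is a pointwise limit of finitely supported functions $\varphi_n$ with $\frac12\sum_{x,y}b(x,y)|\varphi_n(x)-\varphi_n(y)|^2\to0$. A component consisting of a single vertex counts as recurrent. Connected graphs that are not recurrent are called transient. *)

theory Defs
  imports "HOL-Probability.Probability"
begin

definition simplicial_complex :: "'a set \<Rightarrow> 'a set set \<Rightarrow> bool" where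
  "simplicial_complex X K \<longleftrightarrow>
     {} \<in> K \<and>
     (\<forall>\<sigma>\<in>K. finite \<sigma> \<and> \<sigma> \<subseteq> X) \<and>
     (\<forall>\<sigma>\<in>K. \<forall>\<tau>. \<tau> \<subseteq> \<sigma> \<longrightarrow> \<tau> \<in> K) \<and>
     (\<forall>x\<in>X. {x} \<in> K)"

definition simplices :: "'a set \<Rightarrow> 'a set set \<Rightarrow> ('a set \<Rightarrow> real) \<Rightarrow> 'a set set" where
  "simplices X K m = (if (\<lambda>x. m {x}) summable_on X then K else K - {{}})"

definition is_face :: "'a set \<Rightarrow> 'a set \<Rightarrow> bool" where
  "is_face \<tau> \<sigma> \<longleftrightarrow> \<tau> \<subseteq> \<sigma> \<and> card (\<sigma> - \<tau>) = 1"

definition faces :: "'a set set \<Rightarrow> 'a set \<Rightarrow> 'a set set" where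
  "faces S \<sigma> = {\<tau> \<in> S. is_face \<tau> \<sigma>}"

definition cofaces :: "'a set set \<Rightarrow> 'a set \<Rightarrow> 'a set set" where
  "cofaces S \<tau> = {\<sigma> \<in> S. is_face \<tau> \<sigma>}"

definition weighted_simplicial_complex ::
    "'a set \<Rightarrow> 'a set set \<Rightarrow> ('a set \<Rightarrow> real) \<Rightarrow> bool" where
  "weighted_simplicial_complex X K m \<longleftrightarrow>
     simplicial_complex X K \<and>
     (\<forall>\<sigma>\<in>K. m \<sigma> > 0) \<and>
     (\<forall>\<tau>\<in>simplices X K m. m summable_on cofaces (simplices X K m) \<tau>)"

text \<open>
  A function on a set \<open>S\<close> of simplices is represented by a total function on \<open>'a set\<close>; its values
  outside \<open>S\<close> are irrelevant, since every sum below ranges over simplices in \<open>S\<close> only.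
\<close>

definition coboundary ::
    "'a set set \<Rightarrow> ('a set \<Rightarrow> 'a set \<Rightarrow> complex) \<Rightarrow> ('a set \<Rightarrow> complex) \<Rightarrow> 'a set \<Rightarrow> complex" where
  "coboundary S \<theta> \<omega> \<sigma> = (\<Sum>\<tau>\<in>faces S \<sigma>. \<theta> \<tau> \<sigma> * \<omega> \<tau>)"

definition coboundary_coeffs :: "'a set set \<Rightarrow> ('a set \<Rightarrow> 'a set \<Rightarrow> complex) \<Rightarrow> bool" where
  "coboundary_coeffs S \<theta> \<longleftrightarrow>
     (\<forall>\<sigma>\<in>S. \<forall>\<tau>\<in>faces S \<sigma>. \<theta> \<tau> \<sigma> \<in> {1, -1}) \<and>
     (\<forall>\<omega>. \<forall>\<sigma>\<in>S. coboundary S \<theta> (coboundary S \<theta> \<omega>) \<sigma> = 0)"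

definition boundary ::
    "'a set set \<Rightarrow> ('a set \<Rightarrow> real) \<Rightarrow> ('a set \<Rightarrow> 'a set \<Rightarrow> complex) \<Rightarrow>
      ('a set \<Rightarrow> complex) \<Rightarrow> 'a set \<Rightarrow> complex" where
  "boundary S m \<theta> \<omega> \<rho> =
     1 / of_real (m \<rho>) * (\<Sum>\<^sub>\<infinity>\<tau>\<in>cofaces S \<rho>. of_real (m \<tau>) * \<theta> \<rho> \<tau> * \<omega> \<tau>)"

definition boundary_dom :: "'a set set \<Rightarrow> ('a set \<Rightarrow> real) \<Rightarrow> ('a set \<Rightarrow> complex) set" where
  "boundary_dom S m = {\<omega>. \<forall>\<rho>\<in>S. (\<lambda>\<tau>. m \<tau> * cmod (\<omega> \<tau>)) summable_on cofaces S \<rho>}"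

definition ell2 :: "'a set set \<Rightarrow> ('a set \<Rightarrow> real) \<Rightarrow> ('a set \<Rightarrow> complex) set" where
  "ell2 S m = {\<omega>. (\<lambda>\<tau>. m \<tau> * (cmod (\<omega> \<tau>))\<^sup>2) summable_on S}"

definition boundaryN_dom ::
    "'a set set \<Rightarrow> ('a set \<Rightarrow> real) \<Rightarrow> ('a set \<Rightarrow> 'a set \<Rightarrow> complex) \<Rightarrow>
      ('a set \<Rightarrow> complex) set" where
  "boundaryN_dom S m \<theta> = {\<omega> \<in> ell2 S m. boundary S m \<theta> \<omega> \<in> ell2 S m}"

text \<open>
  Square summable functions lie in the domain of the boundary operator. Hence both applications of
  \<^const>\<open>boundary\<close> to an element of \<^const>\<open>boundaryN_dom\<close> are absolutely convergent sums.
\<close>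

lemma ell2_subset_boundary_dom:
  assumes "weighted_simplicial_complex X K m"
  defines "S \<equiv> simplices X K m"
  shows "ell2 S m \<subseteq> boundary_dom S m"
proof
  fix \<omega> assume \<omega>: "\<omega> \<in> ell2 S m"
  have pos: "m \<tau> > 0" if "\<tau> \<in> S" for \<tau>
    using assms that unfolding weighted_simplicial_complex_def simplices_def
    by (auto split: if_splits)
  have "(\<lambda>\<tau>. m \<tau> * cmod (\<omega> \<tau>)) summable_on cofaces S \<rho>" if \<rho>: "\<rho> \<in> S" for \<rho>
  proof (rule summable_on_comparison_test)
    have "m summable_on cofaces S \<rho>"
      using assms(1) \<rho> unfolding weighted_simplicial_complex_def S_def by blast
    moreover have "(\<lambda>\<tau>. m \<tau> * (cmod (\<omega> \<tau>))\<^sup>2) summable_on cofaces S \<rho>"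
      using \<omega> unfolding ell2_def
      by (auto intro: summable_on_subset_banach simp: cofaces_def)
    ultimately show "(\<lambda>\<tau>. m \<tau> + m \<tau> * (cmod (\<omega> \<tau>))\<^sup>2) summable_on cofaces S \<rho>"
      by (rule summable_on_add)
  next
    fix \<tau> assume "\<tau> \<in> cofaces S \<rho>"
    then have m: "m \<tau> > 0" using pos by (simp add: cofaces_def)
    have "cmod (\<omega> \<tau>) \<le> 1 + (cmod (\<omega> \<tau>))\<^sup>2"
      using zero_le_power2[of "cmod (\<omega> \<tau>) - 1"]
      by (simp add: power2_diff) (use norm_ge_zero[of "\<omega> \<tau>"] in linarith)
    from mult_left_mono[OF this, of "m \<tau>"] m
    show "m \<tau> * cmod (\<omega> \<tau>) \<le> m \<tau> + m \<tau> * (cmod (\<omega> \<tau>))\<^sup>2"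
      by (simp add: algebra_simps)
    show "0 \<le> m \<tau> * cmod (\<omega> \<tau>)" using m by simp
  qed
  then show "\<omega> \<in> boundary_dom S m" by (simp add: boundary_dom_def)
qed

definition link :: "'a set \<Rightarrow> 'a set set \<Rightarrow> 'a set \<Rightarrow> 'a set" where
  "link X S \<rho> = {v \<in> X. insert v \<rho> \<in> S \<and> is_face \<rho> (insert v \<rho>)}"

definition link_graph :: "'a set set \<Rightarrow> ('a set \<Rightarrow> real) \<Rightarrow> 'a set \<Rightarrow> 'a \<Rightarrow> 'a \<Rightarrow> real" where
  "link_graph S m \<rho> v v' =
     (if v \<noteq> v' \<and> insert v (insert v' \<rho>) \<in> S then m (insert v (insert v' \<rho>)) else 0)"

definition locally_balanced :: "'a set \<Rightarrow> 'a set set \<Rightarrow> ('a set \<Rightarrow> real) \<Rightarrow> bool" where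
  "locally_balanced X S m \<longleftrightarrow>
     (\<forall>\<rho>\<in>S. bdd_above
        {m (insert v (insert v' \<rho>)) / m (insert v (insert v' \<rho>) - {w}) | v v' w.
           v \<in> link X S \<rho> \<and> v' \<in> link X S \<rho> \<and> v \<noteq> v' \<and>
           insert v (insert v' \<rho>) \<in> S \<and> w \<in> \<rho>})"

definition connected_components_graph :: "'a set \<Rightarrow> ('a \<Rightarrow> 'a \<Rightarrow> real) \<Rightarrow> 'a set set" where
  "connected_components_graph V b = V // {(x, y). x \<in> V \<and> y \<in> V \<and> b x y > 0}\<^sup>*"

definition transition :: "'a set \<Rightarrow> ('a \<Rightarrow> 'a \<Rightarrow> real) \<Rightarrow> 'a \<Rightarrow> 'a \<Rightarrow> real" where
  "transition V b x y = b x y / (\<Sum>\<^sub>\<infinity>z\<in>V. b x z)"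

definition markov_chain ::
    "'w measure \<Rightarrow> 'a set \<Rightarrow> ('a \<Rightarrow> 'a \<Rightarrow> real) \<Rightarrow> (nat \<Rightarrow> 'w \<Rightarrow> 'a) \<Rightarrow> bool" where
  "markov_chain M V p Y \<longleftrightarrow>
     prob_space M \<and>
     (\<forall>n. Y n \<in> measurable M (count_space V)) \<and>
     (\<forall>n s. \<forall>y\<in>V. \<P>(\<omega> in M. \<forall>i\<le>n. Y i \<omega> = s i) > 0 \<longrightarrow>
        \<P>(\<omega> in M. Y (Suc n) \<omega> = y \<bar> \<forall>i\<le>n. Y i \<omega> = s i) = p (s n) y)"

text \<open>
  Recurrence of a connected graph \<open>b\<close> over \<open>V\<close>. The statement only concerns the law of the chain,
  so it loses nothing to let the underlying probability space live on the type of trajectories.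
  By the Ionescu-Tulcea theorem the chain exists for every starting vertex when \<open>b\<close> has more than
  one vertex and finite positive row sums. A single vertex has row sum zero, so there is no chain;
  it is recurrent by convention.
\<close>

definition recurrent_graph :: "'a set \<Rightarrow> ('a \<Rightarrow> 'a \<Rightarrow> real) \<Rightarrow> bool" where
  "recurrent_graph V b \<longleftrightarrow>
     (\<exists>v. V = {v}) \<or>
     (\<forall>(M :: (nat \<Rightarrow> 'a) measure) Y. \<forall>x\<in>V. \<forall>y\<in>V.
        markov_chain M V (transition V b) Y \<and> \<P>(\<omega> in M. Y 0 \<omega> = x) > 0 \<longrightarrow>
        \<P>(\<omega> in M. \<exists>k>0. Y k \<omega> = y \<bar> Y 0 \<omega> = x) = 1)"

end

theory Submission
  imports Defs
begin

text \<open>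
  Fix a simplex \<open>\<rho>\<close>. Writing the simplices above \<open>\<rho>\<close> as \<open>v\<rho>\<close> and \<open>vv'\<rho>\<close>, the value of
  \<open>\<partial>\<partial>\<omega>\<close> at \<open>\<rho>\<close> becomes, up to the factor \<open>1/m(\<rho>)\<close>, an iterated sum over the link of \<open>\<rho>\<close> of
  \<open>g(v,v') = b(v,v') \<theta>(\<rho>,v\<rho>) \<theta>(v\<rho>,vv'\<rho>) \<omega>(vv'\<rho>)\<close> with \<open>b\<close> the link graph
  (\<open>boundary_boundary\<close>). The relation \<open>\<delta>\<delta> = 0\<close> makes \<open>g\<close> antisymmetric, so \<open>g\<close> is a flow on the link
  graph. Square summability of \<open>\<omega>\<close> says that the flow has finite energy, and the inner sum over \<open>v'\<close>,
  its divergence at \<open>v\<close>, is \<open>\<plusminus>m(v\<rho>) \<partial>\<omega>(v\<rho>)\<close>. The vanishing of \<open>\<partial>\<partial>\<omega>(\<rho>)\<close> thus asks whether the divergences of a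
  flow of finite energy add up to zero. A formal rearrangement says yes, but on an infinite graph
  mass can be lost at infinity, and this is what transience of the graph makes possible.

  The bridge between random walks and flows is the capacity of a vertex \<open>p\<close>: the infimum of the
  energies of finitely supported functions that take the value 1 at \<open>p\<close>. If it vanishes, there are
  finitely supported \<open>\<phi>\<^sub>n\<close> that tend to 1 with energies tending to 0; testing the divergence with
  \<open>\<phi>\<^sub>n\<close> and applying Green's formula shows that nothing is lost (\<open>finite_energy_flow_conserved\<close>).
  If it is positive, a minimizing sequence converges to a potential \<open>u\<close> of finite energy whose
  Laplacian is a positive multiple of the point mass at \<open>p\<close> (\<open>equilibrium_potential\<close>), and the gradient of
  \<open>u\<close> is a flow that does lose mass.

  Capacity zero is the same as recurrence (\<open>recurrent_iff_capacity_zero\<close>). The random walk enters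
  only through the probabilities of avoiding a vertex \<open>y\<close> for \<open>n\<close> steps, which satisfy a
  recursion, and their limit \<open>escape\<close>. If the capacities vanish, the escape probability, set to 0
  at \<open>y\<close>, is a bounded subharmonic function and hence constant. If the walk is recurrent, every
  superharmonic function with values in \<open>[0,1]\<close> is constant, which rules out the potential \<open>u\<close>. Here one
  needs that the walk exists, which is the Ionescu-Tulcea theorem.

  For the implication from (i) to (ii), the gradient flow of \<open>u\<close> on a transient component is turned
  back into a function \<open>\<omega>\<close> on the simplices of the form \<open>vv'\<rho>\<close>. Then \<open>\<omega>\<close> is square summable since
  \<open>u\<close> has finite energy, and on the simplices \<open>v\<rho>\<close> the function \<open>\<partial>\<omega>\<close> lives on a single one.
  Besides these, \<open>\<partial>\<omega>\<close> lives on the faces of \<open>vv'\<rho>\<close> that omit a vertex of \<open>\<rho>\<close>, and there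
  local balancedness bounds its norm by that of \<open>\<omega>\<close> (\<open>boundary_gradient_chain_ell2\<close>).
\<close>

section \<open>Limits and summability of infinite sums\<close>

text \<open>
  Off a finite set the majorant has small sum, and there both sums are small uniformly in \<open>n\<close>; on
  the finite set the convergence is termwise.
\<close>

lemma tendsto_infsum_dominated:
  fixes f :: "nat \<Rightarrow> 'a \<Rightarrow> 'b::banach" and h :: "'a \<Rightarrow> real"
  assumes lim: "\<And>x. x \<in> A \<Longrightarrow> (\<lambda>n. f n x) \<longlonglongrightarrow> g x"
    and le: "\<And>n x. x \<in> A \<Longrightarrow> norm (f n x) \<le> h x"
    and h: "h summable_on A"
  shows "(\<lambda>n. infsum (f n) A) \<longlonglongrightarrow> infsum g A"
proof (rule metric_LIMSEQ_I)
  fix e :: real assume e: "0 < e"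
  have gle: "norm (g x) \<le> h x" if "x \<in> A" for x
    using LIMSEQ_le_const2[OF tendsto_norm[OF lim[OF that]]] le[OF that] by blast
  have abs: "f' summable_on B" if "B \<subseteq> A" "\<And>x. x \<in> A \<Longrightarrow> norm (f' x) \<le> h x" for f' :: "'a \<Rightarrow> 'b" and B
    by (rule abs_summable_summable, rule Infinite_Sum.abs_summable_on_comparison_test'[OF summable_on_subset_banach[OF h that(1)]])
       (use that in auto)
  obtain F where F: "finite F" "F \<subseteq> A" "dist (sum h F) (infsum h A) \<le> e/4"
    using infsum_finite_approximation[OF h, of "e/4"] e by auto
  have split: "infsum f' A = sum f' F + infsum f' (A - F)" and
       tail: "norm (infsum f' (A - F)) \<le> infsum h (A - F)"
    if "\<And>x. x \<in> A \<Longrightarrow> norm (f' x) \<le> h x" for f' :: "'a \<Rightarrow> 'b"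
  proof -
    have "A = F \<union> (A - F)" using F by auto
    then show "infsum f' A = sum f' F + infsum f' (A - F)"
      using infsum_Un_disjoint[of f' F "A - F"] abs[OF _ that] F by auto
    show "norm (infsum f' (A - F)) \<le> infsum h (A - F)"
      by (rule norm_infsum_le[OF has_sum_infsum has_sum_infsum])
         (use abs[OF _ that] summable_on_subset_banach[OF h] that in auto)
  qed
  have "infsum h A = sum h F + infsum h (A - F)"
    using infsum_Un_disjoint[of h F "A - F"] summable_on_subset_banach[OF h] F
    by (auto simp: Un_absorb1)
  then have hF: "infsum h (A - F) \<le> e/4" using F(3) by (auto simp: dist_real_def)
  have "(\<lambda>n. sum (f n) F) \<longlonglongrightarrow> sum g F" using lim F by (intro tendsto_sum) auto
  then obtain N where N: "\<And>n. n \<ge> N \<Longrightarrow> dist (sum (f n) F) (sum g F) < e/2"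
    using e by (metis half_gt_zero metric_LIMSEQ_D)
  show "\<exists>N. \<forall>n\<ge>N. dist (infsum (f n) A) (infsum g A) < e"
  proof (intro exI allI impI)
    fix n assume "n \<ge> N"
    have "dist (infsum (f n) A) (infsum g A) =
      norm ((sum (f n) F - sum g F) + (infsum (f n) (A - F) - infsum g (A - F)))"
      using split[of "f n", OF le] split[of g, OF gle] by (simp add: dist_norm algebra_simps)
    also have "\<dots> \<le> norm (sum (f n) F - sum g F) + (norm (infsum (f n) (A - F)) + norm (infsum g (A - F)))"
      by (intro norm_triangle_le add_mono norm_triangle_ineq4 order_refl)
    also have "\<dots> < e/2 + (e/4 + e/4)"
      using N[OF \<open>n \<ge> N\<close>] tail[of "f n", OF le] tail[of g, OF gle] hF by (auto simp: dist_norm)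
    finally show "dist (infsum (f n) A) (infsum g A) < e" by simp
  qed
qed

text \<open>
  The discriminant of a nonnegative quadratic polynomial is not positive. For an energy that is at
  least a constant along a line through an almost minimizer, this bounds the first variation.
\<close>

lemma quadratic_nonneg_imp_discriminant:
  fixes a q r :: real
  assumes "\<And>t. a + 2 * t * r + t\<^sup>2 * q \<ge> 0"
  shows "r\<^sup>2 \<le> a * q"
proof -
  have q: "q \<ge> 0"
  proof (rule ccontr)
    assume "\<not> q \<ge> 0"
    then have q: "q < 0" by simp
    \<comment> \<open>averaging the values at \<open>t\<close> and \<open>-t\<close> removes the linear term\<close>
    have *: "a + t\<^sup>2 * q \<ge> 0" for t
      using assms[of t] assms[of "-t"] by simp
    from *[of "sqrt ((\<bar>a\<bar> + 1) / - q)"] q show False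
      by (auto simp: divide_simps split: if_splits)
  qed
  show ?thesis
  proof (cases "q = 0")
    case True
    have "r = 0"
    proof (rule ccontr)
      assume "r \<noteq> 0"
      then have "2 * (- (\<bar>a\<bar> + 1) / (2 * r)) * r = - (\<bar>a\<bar> + 1)" using \<open>r \<noteq> 0\<close> by simp
      then show False using assms[of "- (\<bar>a\<bar> + 1) / (2 * r)"] unfolding True by simp
    qed
    then show ?thesis using True by simp
  next
    case False
    then have "q > 0" using q by simp
    then show ?thesis using assms[of "- r / q"]
      by (auto simp: field_simps power2_eq_square)
  qed
qed

lemma convergent_if_square_dist_le:
  fixes d e :: "nat \<Rightarrow> real"
  assumes "\<And>n k. (d n - d k)\<^sup>2 \<le> K * (e n + e k)" and "e \<longlonglongrightarrow> 0"
  shows "convergent d"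
proof -
  have "Cauchy d"
  proof (rule metric_CauchyI)
    fix r :: real assume r: "0 < r"
    have "(\<lambda>n. \<bar>K\<bar> * \<bar>e n\<bar>) \<longlonglongrightarrow> \<bar>K\<bar> * \<bar>0\<bar>" using assms(2) by (intro tendsto_intros)
    moreover have "0 < r\<^sup>2/2" using r by simp
    ultimately obtain N where "\<And>n. n \<ge> N \<Longrightarrow> dist (\<bar>K\<bar> * \<bar>e n\<bar>) (\<bar>K\<bar> * \<bar>0\<bar>) < r\<^sup>2/2"
      using metric_LIMSEQ_D by blast
    then have N: "\<bar>K\<bar> * \<bar>e n\<bar> < r\<^sup>2/2" if "n \<ge> N" for n
      using that by (simp add: dist_real_def abs_mult)
    show "\<exists>N. \<forall>m\<ge>N. \<forall>n\<ge>N. dist (d m) (d n) < r"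
    proof (intro exI allI impI)
      fix m n assume mn: "m \<ge> N" "n \<ge> N"
      have "(d m - d n)\<^sup>2 \<le> \<bar>K * e m\<bar> + \<bar>K * e n\<bar>"
        using assms(1)[of m n] by (simp add: distrib_left)
      also have "\<dots> < r\<^sup>2" using N[OF mn(1)] N[OF mn(2)] by (simp add: abs_mult)
      finally have "\<bar>d m - d n\<bar>\<^sup>2 < r\<^sup>2" by simp
      then show "dist (d m) (d n) < r"
        using power2_less_imp_less[of "\<bar>d m - d n\<bar>" r] r by (simp add: dist_real_def)
    qed
  qed
  then show ?thesis by (rule Cauchy_convergent)
qed

lemma has_sum_diff:
  fixes f g :: "'a \<Rightarrow> real"
  assumes "(f has_sum a) A" "(g has_sum c) A"
  shows "((\<lambda>x. f x - g x) has_sum (a - c)) A"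
  using has_sum_add[OF assms(1) has_sum_uminusI[OF assms(2)]] by simp

text \<open>
  Real sums of this kind converge absolutely, so one preimage of each point may be selected.
\<close>

lemma summable_on_image:
  fixes f :: "'b \<Rightarrow> real"
  assumes "(\<lambda>x. f (h x)) summable_on A"
  shows "f summable_on h ` A"
proof -
  obtain B where B: "B \<subseteq> A" "inj_on h B" "h ` A = h ` B" by (metis subset_image_inj subset_refl)
  have "(f \<circ> h) summable_on B" using assms B(1) unfolding comp_def by (rule summable_on_subset_banach)
  then show ?thesis using B(2,3) summable_on_reindex by metis
qed

lemma nn_integral_count_space_infsum:
  fixes f :: "'c \<Rightarrow> real"
  assumes "f summable_on A" "\<And>x. x \<in> A \<Longrightarrow> f x \<ge> 0"
  shows "(\<integral>\<^sup>+x. ennreal (f x) \<partial>count_space A) = ennreal (infsum f A)"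
proof -
  have "Infinite_Set_Sum.abs_summable_on f A"
    using assms(1) abs_summable_equivalent summable_on_iff_abs_summable_on_real by blast
  then show ?thesis
    using assms(2) by (simp add: nn_integral_conv_infsetsum infsetsum_infsum)
qed

lemma (in prob_space) measure_UN_countable_infsum:
  assumes I: "countable I" and sets: "\<And>i. i \<in> I \<Longrightarrow> E i \<in> events" and disj: "disjoint_family_on E I"
    and eq: "\<And>i. i \<in> I \<Longrightarrow> prob (E i) = f i" and f: "f summable_on I"
  shows "prob (\<Union>i\<in>I. E i) = infsum f I"
proof -
  have nn: "f i \<ge> 0" if "i \<in> I" for i using eq[OF that] measure_nonneg[of M "E i"] by simp
  have "ennreal (prob (\<Union>i\<in>I. E i)) = (\<integral>\<^sup>+i. emeasure M (E i) \<partial>count_space I)"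
    unfolding emeasure_eq_measure[symmetric] by (rule emeasure_UN_countable[OF sets I disj])
  also have "\<dots> = (\<integral>\<^sup>+i. ennreal (f i) \<partial>count_space I)"
    by (rule nn_integral_cong) (simp add: emeasure_eq_measure eq)
  also have "\<dots> = ennreal (infsum f I)" by (rule nn_integral_count_space_infsum[OF f nn])
  finally show ?thesis using infsum_nonneg[OF nn, of I] by simp
qed

section \<open>Energy and capacity on weighted graphs\<close>

locale weighted_graph =
  fixes V :: "'a set" and b :: "'a \<Rightarrow> 'a \<Rightarrow> real"
  assumes b_nonneg: "\<And>x y. x \<in> V \<Longrightarrow> y \<in> V \<Longrightarrow> b x y \<ge> 0"
    and b_sym: "\<And>x y. x \<in> V \<Longrightarrow> y \<in> V \<Longrightarrow> b x y = b y x"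
    and b_summable: "\<And>x. x \<in> V \<Longrightarrow> b x summable_on V"
    and connected: "\<And>x y. x \<in> V \<Longrightarrow> y \<in> V \<Longrightarrow> (x, y) \<in> {(x, y). x \<in> V \<and> y \<in> V \<and> b x y > 0}\<^sup>*"
    and countable_V: "countable V"
begin

text \<open>
  Test functions live on the whole type and vanish off \<open>V\<close>, so that they form a vector space.
\<close>

definition finite_support :: "('a \<Rightarrow> real) \<Rightarrow> bool" where
  "finite_support \<phi> \<longleftrightarrow> finite {x. \<phi> x \<noteq> 0} \<and> {x. \<phi> x \<noteq> 0} \<subseteq> V"

text \<open>
  The sum runs over ordered pairs, hence counts every edge twice. This accounts for the factors 2
  in Green's formula and for the factor 1/2 at the pole of the equilibrium potential.
\<close>

definition energy_form :: "('a \<Rightarrow> real) \<Rightarrow> ('a \<Rightarrow> real) \<Rightarrow> real" where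
  "energy_form \<phi> \<psi> = (\<Sum>\<^sub>\<infinity>(x, y)\<in>V \<times> V. b x y * (\<phi> x - \<phi> y) * (\<psi> x - \<psi> y))"

abbreviation energy :: "('a \<Rightarrow> real) \<Rightarrow> real" where
  "energy \<phi> \<equiv> energy_form \<phi> \<phi>"

definition laplacian :: "('a \<Rightarrow> real) \<Rightarrow> 'a \<Rightarrow> real" where
  "laplacian \<phi> x = (\<Sum>\<^sub>\<infinity>y\<in>V. b x y * (\<phi> x - \<phi> y))"

definition capacity :: "'a \<Rightarrow> real" where
  "capacity p = Inf {energy \<phi> | \<phi>. finite_support \<phi> \<and> \<phi> p = 1}"

lemma finite_support_add:
  assumes "finite_support \<phi>" "finite_support \<psi>"
  shows "finite_support (\<lambda>x. \<phi> x + t * \<psi> x)"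
proof -
  have "{x. \<phi> x + t * \<psi> x \<noteq> 0} \<subseteq> {x. \<phi> x \<noteq> 0} \<union> {x. \<psi> x \<noteq> 0}" by auto
  then show ?thesis
    using assms unfolding finite_support_def by (meson finite_UnI finite_subset le_sup_iff order_trans)
qed

lemma finite_support_subset: "finite_support \<phi> \<Longrightarrow> (\<And>x. \<phi> x = 0 \<Longrightarrow> \<psi> x = 0) \<Longrightarrow> finite_support \<psi>"
  unfolding finite_support_def by (auto intro: finite_subset[of _ "{x. \<phi> x \<noteq> 0}"])

lemma finite_support_indicator: "x \<in> V \<Longrightarrow> finite_support (indicator {x})"
  unfolding finite_support_def by (auto simp: indicator_def)

lemma finite_support_bounded: "finite_support \<phi> \<Longrightarrow> \<exists>B. \<forall>x. \<bar>\<phi> x\<bar> \<le> B"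
proof (intro exI allI)
  assume fs: "finite_support \<phi>"
  fix x show "\<bar>\<phi> x\<bar> \<le> (\<Sum>x\<in>{x. \<phi> x \<noteq> 0}. \<bar>\<phi> x\<bar>)"
    using fs member_le_sum[of x "{x. \<phi> x \<noteq> 0}" "\<lambda>x. \<bar>\<phi> x\<bar>"]
    by (cases "\<phi> x = 0") (auto simp: finite_support_def sum_nonneg)
qed

text \<open>
  Summation by parts. The double sum of \<open>\<psi> x\<close> times \<open>g x y\<close> converges absolutely because
  \<open>\<psi>\<close> has finite support; exchanging the names of \<open>x\<close> and \<open>y\<close> and using antisymmetry gives
  the second half of the difference \<open>\<psi> x - \<psi> y\<close>.
\<close>

lemma Green:
  fixes g :: "'a \<Rightarrow> 'a \<Rightarrow> 'b::banach"
  assumes \<psi>: "finite_support \<psi>"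
    and anti: "\<And>x y. x \<in> V \<Longrightarrow> y \<in> V \<Longrightarrow> g y x = - g x y"
    and row: "\<And>x. x \<in> V \<Longrightarrow> (\<lambda>y. norm (g x y)) summable_on V"
  shows "((\<lambda>(x, y). (\<psi> x - \<psi> y) *\<^sub>R g x y) has_sum
           2 *\<^sub>R (\<Sum>\<^sub>\<infinity>x\<in>V. \<psi> x *\<^sub>R (\<Sum>\<^sub>\<infinity>y\<in>V. g x y))) (V \<times> V)"
proof -
  let ?h = "\<lambda>(x, y). \<psi> x *\<^sub>R g x y"
  let ?s = "\<Sum>\<^sub>\<infinity>x\<in>V. \<psi> x *\<^sub>R (\<Sum>\<^sub>\<infinity>y\<in>V. g x y)"
  have abs: "(\<lambda>p. norm (?h p)) summable_on V \<times> V"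
  proof (rule summable_on_SigmaI)
    fix x assume "x \<in> V"
    then show "((\<lambda>y. norm (?h (x, y))) has_sum \<bar>\<psi> x\<bar> * (\<Sum>\<^sub>\<infinity>y\<in>V. norm (g x y))) V"
      by (auto intro!: has_sum_cmult_right row has_sum_infsum)
  next
    show "(\<lambda>x. \<bar>\<psi> x\<bar> * (\<Sum>\<^sub>\<infinity>y\<in>V. norm (g x y))) summable_on V"
      by (rule finite_nonzero_values_imp_summable_on)
         (use \<psi> in \<open>auto simp: finite_support_def intro: finite_subset[of _ "{x. \<psi> x \<noteq> 0}"]\<close>)
  qed auto
  then have sh: "?h summable_on V \<times> V" by (rule abs_summable_summable)
  have "infsum ?h (V \<times> V) = (\<Sum>\<^sub>\<infinity>x\<in>V. \<Sum>\<^sub>\<infinity>y\<in>V. \<psi> x *\<^sub>R g x y)"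
    using infsum_Sigma'_banach[of "\<lambda>x y. \<psi> x *\<^sub>R g x y" V "\<lambda>_. V"] sh by simp
  also have "\<dots> = ?s" by (intro infsum_cong infsum_scaleR_right)
  finally have h: "(?h has_sum ?s) (V \<times> V)" using has_sum_infsum[OF sh] by simp
  have "((\<lambda>(x, y). ?h (y, x)) has_sum ?s) (V \<times> V)"
    using h by (subst (asm) has_sum_swap) simp
  from has_sum_add[OF h this]
  have "((\<lambda>p. ?h p + (case p of (x, y) \<Rightarrow> ?h (y, x))) has_sum 2 *\<^sub>R ?s) (V \<times> V)" by (simp add: scaleR_2)
  then show ?thesis
    by (rule has_sum_cong[THEN iffD1, rotated])
       (clarsimp simp: scaleR_diff_left, metis anti scaleR_minus_right)
qed

lemma row_summable:
  assumes "\<forall>x. \<bar>\<phi> x\<bar> \<le> B" "x \<in> V"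
  shows "(\<lambda>y. norm (b x y * (\<phi> x - \<phi> y))) summable_on V"
proof (rule Infinite_Sum.abs_summable_on_comparison_test')
  show "(\<lambda>y. b x y * (2 * B)) summable_on V" using b_summable[OF assms(2)] by (rule summable_on_cmult_left)
  fix y assume y: "y \<in> V"
  have "\<bar>\<phi> x - \<phi> y\<bar> \<le> 2 * B" using assms(1)[rule_format, of x] assms(1)[rule_format, of y] by linarith
  then show "norm (b x y * (\<phi> x - \<phi> y)) \<le> b x y * (2 * B)"
    using b_nonneg[OF assms(2) y] by (simp add: abs_mult mult_left_mono)
qed

lemma energy_form_has_sum:
  assumes "\<forall>x. \<bar>\<phi> x\<bar> \<le> B" "finite_support \<psi>"
  shows "((\<lambda>(x, y). b x y * (\<phi> x - \<phi> y) * (\<psi> x - \<psi> y)) has_sum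
     2 * (\<Sum>\<^sub>\<infinity>x\<in>V. \<psi> x * laplacian \<phi> x)) (V \<times> V)"
proof -
  have "b y x * (\<phi> y - \<phi> x) = - (b x y * (\<phi> x - \<phi> y))" if "x \<in> V" "y \<in> V" for x y
    using b_sym[OF that] by (simp add: algebra_simps)
  from Green[OF assms(2) this row_summable[OF assms(1)]] show ?thesis
    by (simp add: laplacian_def mult.commute)
qed

lemma energy_form_summable:
  assumes "finite_support \<phi>" "finite_support \<psi>"
  shows "(\<lambda>(x, y). b x y * (\<phi> x - \<phi> y) * (\<psi> x - \<psi> y)) summable_on V \<times> V"
proof -
  obtain B where "\<forall>x. \<bar>\<phi> x\<bar> \<le> B" using finite_support_bounded[OF assms(1)] by blast
  from energy_form_has_sum[OF this assms(2)] show ?thesis by (rule has_sum_imp_summable)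
qed

lemma energy_form_indicator:
  assumes "\<forall>x. \<bar>\<phi> x\<bar> \<le> B" "x \<in> V"
  shows "energy_form \<phi> (indicator {x}) = 2 * laplacian \<phi> x"
proof -
  have "(\<Sum>\<^sub>\<infinity>z\<in>V. indicator {x} z * laplacian \<phi> z) = (\<Sum>\<^sub>\<infinity>z\<in>{x}. laplacian \<phi> z)"
    by (rule infsum_cong_neutral) (use assms(2) in auto)
  with energy_form_has_sum[OF assms(1) finite_support_indicator[OF assms(2)]]
  show ?thesis by (simp add: energy_form_def infsumI)
qed

lemma energy_add:
  assumes "finite_support \<phi>" "finite_support \<psi>"
  shows "energy (\<lambda>x. \<phi> x + t * \<psi> x) = energy \<phi> + 2 * t * energy_form \<phi> \<psi> + t\<^sup>2 * energy \<psi>"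
proof -
  let ?f = "\<lambda>\<phi> \<psi> (x, y). b x y * (\<phi> x - \<phi> y) * (\<psi> x - \<psi> y)"
  have s: "(?f \<phi> \<psi> has_sum energy_form \<phi> \<psi>) (V \<times> V)" if "finite_support \<phi>" "finite_support \<psi>" for \<phi> \<psi>
    using energy_form_summable[OF that] unfolding energy_form_def by (rule has_sum_infsum)
  have "((\<lambda>p. ?f \<phi> \<phi> p + 2 * t * ?f \<phi> \<psi> p + t\<^sup>2 * ?f \<psi> \<psi> p) has_sum
     (energy \<phi> + 2 * t * energy_form \<phi> \<psi> + t\<^sup>2 * energy \<psi>)) (V \<times> V)"
    by (intro has_sum_add has_sum_cmult_right s assms)
  also have "(\<lambda>p. ?f \<phi> \<phi> p + 2 * t * ?f \<phi> \<psi> p + t\<^sup>2 * ?f \<psi> \<psi> p) = ?f (\<lambda>x. \<phi> x + t * \<psi> x) (\<lambda>x. \<phi> x + t * \<psi> x)"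
    by (auto simp: fun_eq_iff algebra_simps power2_eq_square)
  finally show ?thesis by (simp add: energy_form_def infsumI)
qed

lemma energy_nonneg: "energy \<phi> \<ge> 0"
  unfolding energy_form_def by (rule infsum_nonneg) (auto simp: b_nonneg mult.assoc)

lemma energy_scale: "energy (\<lambda>x. t * \<phi> x) = t\<^sup>2 * energy \<phi>"
proof -
  have "(\<lambda>(x, y). b x y * (t * \<phi> x - t * \<phi> y) * (t * \<phi> x - t * \<phi> y)) =
    (\<lambda>p. t\<^sup>2 * (case p of (x, y) \<Rightarrow> b x y * (\<phi> x - \<phi> y) * (\<phi> x - \<phi> y)))"
    by (auto simp: fun_eq_iff algebra_simps power2_eq_square)
  then show ?thesis unfolding energy_form_def by (simp add: infsum_cmult_right')
qed

lemma edge_le_energy: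
  assumes "finite_support \<phi>" "x \<in> V" "y \<in> V"
  shows "b x y * (\<phi> x - \<phi> y)\<^sup>2 \<le> energy \<phi>"
  using finite_sum_le_infsum[OF energy_form_summable[OF assms(1,1)], of "{(x, y)}"] assms b_nonneg
  by (auto simp: energy_form_def power2_eq_square mult.assoc)

lemma energy_mono:
  assumes "finite_support \<phi>" "finite_support \<psi>"
    and "\<And>x y. x \<in> V \<Longrightarrow> y \<in> V \<Longrightarrow> \<bar>\<psi> x - \<psi> y\<bar> \<le> \<bar>\<phi> x - \<phi> y\<bar>"
  shows "energy \<psi> \<le> energy \<phi>"
  unfolding energy_form_def
proof (rule infsum_mono[OF energy_form_summable[OF assms(2,2)] energy_form_summable[OF assms(1,1)]], clarsimp)
  fix x y assume "x \<in> V" "y \<in> V"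
  then show "b x y * (\<psi> x - \<psi> y) * (\<psi> x - \<psi> y) \<le> b x y * (\<phi> x - \<phi> y) * (\<phi> x - \<phi> y)"
    using mult_left_mono[OF assms(3)[unfolded abs_le_square_iff] b_nonneg]
    by (simp add: power2_eq_square mult.assoc)
qed

text \<open>
  Truncation to \<open>[0,1]\<close> contracts differences and fixes 0 and 1, so almost minimizers of the
  energy may be taken with values in \<open>[0,1]\<close>.
\<close>

definition clip :: "('a \<Rightarrow> real) \<Rightarrow> 'a \<Rightarrow> real" where
  "clip \<phi> x = max 0 (min 1 (\<phi> x))"

lemma finite_support_clip: "finite_support \<phi> \<Longrightarrow> finite_support (clip \<phi>)"
  by (erule finite_support_subset) (auto simp: clip_def)

lemma energy_clip: "finite_support \<phi> \<Longrightarrow> energy (clip \<phi>) \<le> energy \<phi>"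
proof (rule energy_mono)
  have "\<bar>max 0 (min 1 r) - max 0 (min 1 s)\<bar> \<le> \<bar>r - s\<bar>" for r s :: real by linarith
  then show "\<bar>clip \<phi> x - clip \<phi> y\<bar> \<le> \<bar>\<phi> x - \<phi> y\<bar>" for x y unfolding clip_def .
qed (auto simp: finite_support_clip)

text \<open>
  Properties that propagate along edges hold everywhere once they hold somewhere.
\<close>

lemma connected_induct:
  assumes "x \<in> V" "y \<in> V" "P x" "\<And>x y. x \<in> V \<Longrightarrow> y \<in> V \<Longrightarrow> b x y > 0 \<Longrightarrow> P x \<Longrightarrow> P y"
  shows "P y"
  using connected[OF assms(1,2)] by (induction rule: rtrancl_induct) (use assms in auto)

lemma capacity_le: "finite_support \<phi> \<Longrightarrow> \<phi> p = 1 \<Longrightarrow> capacity p \<le> energy \<phi>"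
  unfolding capacity_def by (rule cInf_lower) (auto intro!: bdd_belowI[of _ 0] energy_nonneg)

lemma capacity_nonneg: "p \<in> V \<Longrightarrow> capacity p \<ge> 0"
  unfolding capacity_def
  by (rule cInf_greatest) (auto intro: energy_nonneg finite_support_indicator exI[of _ "indicator {p}"])

lemma capacity_lessE:
  assumes "p \<in> V" "capacity p < e"
  obtains \<phi> where "finite_support \<phi>" "\<phi> p = 1" "\<And>x. 0 \<le> \<phi> x" "\<And>x. \<phi> x \<le> 1" "energy \<phi> < e"
proof -
  have "{energy \<phi> | \<phi>. finite_support \<phi> \<and> \<phi> p = 1} \<noteq> {}"
    using finite_support_indicator[OF assms(1)] by (auto intro: exI[of _ "indicator {p}"])
  from cInf_lessD[OF this, of e] assms(2)
  obtain \<phi> where \<phi>: "finite_support \<phi>" "\<phi> p = 1" "energy \<phi> < e"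
    unfolding capacity_def by auto
  show thesis
    by (rule that[of "clip \<phi>"])
       (use finite_support_clip[OF \<phi>(1)] energy_clip[OF \<phi>(1)] \<phi>(2,3) in \<open>auto simp: clip_def\<close>)
qed

lemma capacity_mult_le_energy:
  assumes "finite_support \<psi>"
  shows "capacity p * (\<psi> p)\<^sup>2 \<le> energy \<psi>"
proof (cases "\<psi> p = 0")
  case False
  have "capacity p \<le> energy (\<lambda>x. inverse (\<psi> p) * \<psi> x)"
    by (rule capacity_le) (use False in \<open>auto intro: finite_support_subset[OF assms]\<close>)
  then show ?thesis unfolding energy_scale using False by (simp add: field_simps)
qed (simp add: energy_nonneg)

text \<open>
  The Euler-Lagrange equation with an error term. By homogeneity, \<open>\<phi> + t\<psi>\<close> has energy at least
  \<open>capacity p * (1 + t * \<psi> p)\<^sup>2\<close> for all \<open>t\<close>, and the discriminant of this quadratic inequality is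
  the claim. As \<open>\<phi>\<close> runs through a minimizing sequence, the right-hand side tends to 0.
\<close>

lemma near_minimizer_energy_form:
  assumes "finite_support \<phi>" "finite_support \<psi>" "\<phi> p = 1"
  shows "(energy_form \<phi> \<psi> - capacity p * \<psi> p)\<^sup>2
    \<le> (energy \<phi> - capacity p) * (energy \<psi> - capacity p * (\<psi> p)\<^sup>2)"
proof (rule quadratic_nonneg_imp_discriminant)
  fix t :: real
  have "capacity p * (1 + t * \<psi> p)\<^sup>2 \<le> energy (\<lambda>x. \<phi> x + t * \<psi> x)"
    using capacity_mult_le_energy[OF finite_support_add[OF assms(1,2)], of p t] unfolding assms(3) .
  then show "0 \<le> (energy \<phi> - capacity p) + 2 * t * (energy_form \<phi> \<psi> - capacity p * \<psi> p)
      + t\<^sup>2 * (energy \<psi> - capacity p * (\<psi> p)\<^sup>2)"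
    unfolding energy_add[OF assms(1,2)] by (simp add: algebra_simps power2_eq_square)
qed

text \<open>
  The parallelogram law: the midpoint of two almost minimizers is again a competitor.
\<close>

lemma near_minimizers_close:
  assumes "finite_support \<phi>" "finite_support \<psi>" "\<phi> p = 1" "\<psi> p = 1"
  shows "energy (\<lambda>x. \<psi> x - \<phi> x) \<le> 2 * ((energy \<phi> - capacity p) + (energy \<psi> - capacity p))"
proof -
  let ?d = "\<lambda>x. \<psi> x - \<phi> x"
  have d: "finite_support ?d" using finite_support_add[OF assms(2,1), of "-1"] by simp
  have "capacity p \<le> energy (\<lambda>x. \<phi> x + 1/2 * ?d x)"
    by (rule capacity_le) (use assms d finite_support_add[OF assms(1) d, of "1/2"] in auto)
  then have "capacity p \<le> energy \<phi> + energy_form \<phi> ?d + energy ?d / 4"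
    unfolding energy_add[OF assms(1) d] by (simp add: power2_eq_square)
  moreover have "energy \<psi> = energy \<phi> + 2 * energy_form \<phi> ?d + energy ?d"
    using energy_add[OF assms(1) d, of 1] by simp
  moreover have "D \<le> 2 * ((A - c) + (P - c))" if "c \<le> A + B + D / 4" "P = A + 2 * B + D" for A B c D P :: real
    using that by (simp add: field_simps)
  ultimately show ?thesis by blast
qed

lemma laplacian_tendsto:
  assumes "\<And>n x. \<bar>\<phi> n x\<bar> \<le> B" "\<And>x. (\<lambda>n. \<phi> n x) \<longlonglongrightarrow> u x" "x \<in> V"
  shows "(\<lambda>n. laplacian (\<phi> n) x) \<longlonglongrightarrow> laplacian u x"
  unfolding laplacian_def
proof (rule tendsto_infsum_dominated)
  show "(\<lambda>y. b x y * (2 * B)) summable_on V" using b_summable[OF assms(3)] by (rule summable_on_cmult_left)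
  fix n y assume y: "y \<in> V"
  have "\<bar>\<phi> n x - \<phi> n y\<bar> \<le> 2 * B" using assms(1)[of n x] assms(1)[of n y] by linarith
  then show "norm (b x y * (\<phi> n x - \<phi> n y)) \<le> b x y * (2 * B)"
    using b_nonneg[OF assms(3) y] by (simp add: abs_mult mult_left_mono)
qed (intro tendsto_intros assms)

text \<open>
  A minimizing sequence normalized at \<open>p\<close> is Cauchy in energy, hence pointwise along every path
  from \<open>p\<close>. The energy of the limit is finite by Fatou, and its Laplacian is the
  limit of the first variations in the directions of the indicators of single vertices.
\<close>

lemma equilibrium_potential:
  assumes p: "p \<in> V"
  shows "\<exists>u. (\<forall>x. 0 \<le> u x \<and> u x \<le> 1) \<and> (\<lambda>(x, y). b x y * (u x - u y)\<^sup>2) summable_on V \<times> V \<and>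
    (\<forall>x\<in>V. laplacian u x = (if x = p then capacity p / 2 else 0))"
proof -
  let ?c = "capacity p"
  have "\<exists>\<phi>. finite_support \<phi> \<and> \<phi> p = 1 \<and> (\<forall>x. 0 \<le> \<phi> x \<and> \<phi> x \<le> 1) \<and> energy \<phi> < ?c + 1 / Suc n" for n
    by (rule capacity_lessE[OF p, of "?c + 1 / Suc n"]) auto
  then obtain \<phi> where \<phi>: "\<And>n. finite_support (\<phi> n)" "\<And>n. \<phi> n p = 1"
      "\<And>n x. 0 \<le> \<phi> n x" "\<And>n x. \<phi> n x \<le> 1" "\<And>n. energy (\<phi> n) < ?c + 1 / Suc n"
    by metis
  define e where "e n = energy (\<phi> n) - ?c" for n
  have e_nonneg: "e n \<ge> 0" for n using capacity_le[OF \<phi>(1,2)] by (simp add: e_def)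
  have e_le: "e n \<le> 1 / Suc n" for n using \<phi>(5)[of n] by (simp add: e_def)
  have e: "e \<longlonglongrightarrow> 0"
    by (rule tendsto_sandwich[OF _ _ tendsto_const LIMSEQ_inverse_real_of_nat])
       (use e_nonneg e_le in \<open>auto simp: inverse_eq_divide\<close>)
  \<comment> \<open>energy only controls differences along edges; the value 1 at \<open>p\<close> starts the propagation\<close>
  have diff: "convergent (\<lambda>n. \<phi> n x - \<phi> n y)" if xy: "x \<in> V" "y \<in> V" "b x y > 0" for x y
  proof (rule convergent_if_square_dist_le[OF _ e])
    fix n k
    have "b x y * ((\<phi> n x - \<phi> k x) - (\<phi> n y - \<phi> k y))\<^sup>2 \<le> energy (\<lambda>x. \<phi> n x - \<phi> k x)"
      using edge_le_energy[OF finite_support_add[OF \<phi>(1) \<phi>(1), of n "-1" k] xy(1,2)] by simp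
    also have "\<dots> \<le> 2 * (e k + e n)"
      using near_minimizers_close[OF \<phi>(1) \<phi>(1) \<phi>(2) \<phi>(2)] by (simp add: e_def)
    finally show "((\<phi> n x - \<phi> n y) - (\<phi> k x - \<phi> k y))\<^sup>2 \<le> (2 / b x y) * (e n + e k)"
      using xy(3) by (simp add: field_simps)
  qed
  have conv: "convergent (\<lambda>n. \<phi> n x)" for x
  proof (cases "x \<in> V")
    case True
    show ?thesis
    proof (rule connected_induct[OF p True])
      show "convergent (\<lambda>n. \<phi> n p)" by (simp add: \<phi>(2) convergent_const)
      fix x y assume "x \<in> V" "y \<in> V" "b x y > 0" "convergent (\<lambda>n. \<phi> n x)"
      from convergent_diff[OF this(4) diff[OF this(1-3)]] show "convergent (\<lambda>n. \<phi> n y)" by simp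
    qed
  next
    case False
    then have "\<phi> n x = 0" for n using \<phi>(1)[of n] unfolding finite_support_def by auto
    then show ?thesis by (simp add: convergent_const)
  qed
  define u where "u x = lim (\<lambda>n. \<phi> n x)" for x
  have lim: "(\<lambda>n. \<phi> n x) \<longlonglongrightarrow> u x" for x
    unfolding u_def using conv by (simp add: convergent_LIMSEQ_iff)
  have "0 \<le> u x" "u x \<le> 1" for x
    using LIMSEQ_le_const[OF lim] LIMSEQ_le_const2[OF lim] \<phi>(3,4) by blast+
  moreover have "(\<lambda>(x, y). b x y * (u x - u y)\<^sup>2) summable_on V \<times> V"
  proof (rule nonneg_bdd_above_summable_on)
    show "bdd_above (sum (\<lambda>(x, y). b x y * (u x - u y)\<^sup>2) ` {F. F \<subseteq> V \<times> V \<and> finite F})"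
    proof (rule bdd_aboveI2, clarify)
      fix F assume F: "F \<subseteq> V \<times> V" "finite F"
      have "(\<lambda>n. \<Sum>(x, y)\<in>F. b x y * (\<phi> n x - \<phi> n y)\<^sup>2) \<longlonglongrightarrow> (\<Sum>(x, y)\<in>F. b x y * (u x - u y)\<^sup>2)"
        unfolding case_prod_beta by (intro tendsto_intros lim)
      moreover have "(\<Sum>(x, y)\<in>F. b x y * (\<phi> n x - \<phi> n y)\<^sup>2) \<le> ?c + 1" for n
      proof -
        have "(\<Sum>(x, y)\<in>F. b x y * (\<phi> n x - \<phi> n y)\<^sup>2) = (\<Sum>(x, y)\<in>F. b x y * (\<phi> n x - \<phi> n y) * (\<phi> n x - \<phi> n y))"
          by (simp add: power2_eq_square mult.assoc)
        also have "\<dots> \<le> energy (\<phi> n)"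
          unfolding energy_form_def
          by (rule finite_sum_le_infsum[OF energy_form_summable[OF \<phi>(1) \<phi>(1)]])
             (use F b_nonneg in \<open>auto simp: mult.assoc\<close>)
        also have "\<dots> \<le> ?c + 1"
        proof -
          have "1 / real (Suc n) \<le> 1" by simp
          then show ?thesis using e_le[of n] unfolding e_def by linarith
        qed
        finally show ?thesis .
      qed
      ultimately show "(\<Sum>(x, y)\<in>F. b x y * (u x - u y)\<^sup>2) \<le> ?c + 1"
        by (intro LIMSEQ_le_const2) auto
    qed
  qed (use b_nonneg in auto)
  moreover have "laplacian u x = (if x = p then ?c / 2 else 0)" if x: "x \<in> V" for x
  proof -
    let ?\<psi> = "indicator {x} :: 'a \<Rightarrow> real"
    let ?K = "energy ?\<psi> - ?c * (?\<psi> p)\<^sup>2"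
    have bd: "\<bar>\<phi> n x\<bar> \<le> 1" for n x using \<phi>(3,4)[of n x] by simp
    have "(2 * laplacian (\<phi> n) x - ?c * ?\<psi> p)\<^sup>2 \<le> e n * ?K" for n
      using near_minimizer_energy_form[OF \<phi>(1) finite_support_indicator[OF x] \<phi>(2), of n]
        energy_form_indicator[OF _ x, of "\<phi> n" 1] bd by (simp add: e_def)
    then have "\<forall>\<^sub>F n in sequentially. norm ((2 * laplacian (\<phi> n) x - ?c * ?\<psi> p)\<^sup>2) \<le> e n * ?K" by simp
    moreover have "(\<lambda>n. e n * ?K) \<longlonglongrightarrow> 0" using tendsto_mult_right[OF e, of ?K] by simp
    ultimately have "(\<lambda>n. (2 * laplacian (\<phi> n) x - ?c * ?\<psi> p)\<^sup>2) \<longlonglongrightarrow> 0"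
      by (rule Lim_null_comparison)
    moreover have "(\<lambda>n. (2 * laplacian (\<phi> n) x - ?c * ?\<psi> p)\<^sup>2) \<longlonglongrightarrow> (2 * laplacian u x - ?c * ?\<psi> p)\<^sup>2"
      by (intro tendsto_intros laplacian_tendsto[OF bd lim x])
    ultimately have "(2 * laplacian u x - ?c * ?\<psi> p)\<^sup>2 = 0" by (rule LIMSEQ_unique[symmetric])
    then show ?thesis by (auto simp: indicator_def)
  qed
  ultimately show ?thesis by blast
qed

text \<open>
  Small energy forces neighbouring values to agree in the limit, so the value 1 at \<open>p\<close> spreads
  over the whole graph. The energies are bounded by squares
  because their square roots serve as weights in the estimate for flows.
\<close>

lemma null_sequence:
  assumes p: "p \<in> V" and cap: "capacity p = 0"
  obtains \<phi> :: "nat \<Rightarrow> 'a \<Rightarrow> real" where "\<And>n. finite_support (\<phi> n)" "\<And>n x. 0 \<le> \<phi> n x" "\<And>n x. \<phi> n x \<le> 1"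
    "\<And>n. energy (\<phi> n) \<le> (1 / Suc n)\<^sup>2" "\<And>x. x \<in> V \<Longrightarrow> (\<lambda>n. \<phi> n x) \<longlonglongrightarrow> 1"
proof -
  have "\<exists>\<phi>. finite_support \<phi> \<and> \<phi> p = 1 \<and> (\<forall>x. 0 \<le> \<phi> x \<and> \<phi> x \<le> 1) \<and> energy \<phi> < (1 / Suc n)\<^sup>2" for n
    by (rule capacity_lessE[OF p, of "(1 / Suc n)\<^sup>2"]) (auto simp: cap)
  then obtain \<phi> where \<phi>: "\<And>n. finite_support (\<phi> n)" "\<And>n. \<phi> n p = 1"
      "\<And>n x. 0 \<le> \<phi> n x" "\<And>n x. \<phi> n x \<le> 1" "\<And>n. energy (\<phi> n) < (1 / Suc n)\<^sup>2"
    by metis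
  have lim: "(\<lambda>n. \<phi> n x) \<longlonglongrightarrow> 1" if x: "x \<in> V" for x
  proof (rule connected_induct[OF p x])
    fix x y assume xy: "x \<in> V" "y \<in> V" "b x y > 0" and lim: "(\<lambda>n. \<phi> n x) \<longlonglongrightarrow> 1"
    have "\<bar>\<phi> n x - \<phi> n y\<bar> \<le> (1 / sqrt (b x y)) * (1 / Suc n)" for n
    proof -
      have "b x y * (\<phi> n x - \<phi> n y)\<^sup>2 \<le> (1 / Suc n)\<^sup>2"
        using edge_le_energy[OF \<phi>(1)[of n] xy(1,2)] \<phi>(5)[of n] by simp
      then have "\<bar>\<phi> n x - \<phi> n y\<bar>\<^sup>2 \<le> ((1 / sqrt (b x y)) * (1 / Suc n))\<^sup>2"
        using xy(3) by (simp add: power_mult_distrib power_divide pos_le_divide_eq mult_ac)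
      then show ?thesis by (rule power2_le_imp_le) (use xy(3) in auto)
    qed
    then have "\<forall>\<^sub>F n in sequentially. norm (\<phi> n x - \<phi> n y) \<le> (1 / sqrt (b x y)) * (1 / Suc n)" by simp
    moreover have "(\<lambda>n. (1 / sqrt (b x y)) * (1 / Suc n)) \<longlonglongrightarrow> 0"
      using tendsto_mult_left[OF LIMSEQ_inverse_real_of_nat, of "1 / sqrt (b x y)"] by (simp add: inverse_eq_divide)
    ultimately have "(\<lambda>n. \<phi> n x - \<phi> n y) \<longlonglongrightarrow> 0"
      by (rule Lim_null_comparison)
    from tendsto_diff[OF lim this] show "(\<lambda>n. \<phi> n y) \<longlonglongrightarrow> 1" by simp
  qed (simp add: \<phi>(2))
  show thesis by (rule that[of \<phi>]) (use \<phi> lim less_imp_le in blast)+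
qed

text \<open>
  Test the divergence with the null sequence. Green's formula turns the result into a pairing of the
  flow with the gradients of \<open>\<phi>\<^sub>n\<close>, which tends to 0 since the flow has finite energy, while dominated
  convergence identifies the limit as the total divergence.
\<close>

lemma finite_energy_flow_conserved:
  fixes g :: "'a \<Rightarrow> 'a \<Rightarrow> 'b::banach"
  assumes p: "p \<in> V" "capacity p = 0"
    and anti: "\<And>x y. x \<in> V \<Longrightarrow> y \<in> V \<Longrightarrow> g y x = - g x y"
    and supp: "\<And>x y. x \<in> V \<Longrightarrow> y \<in> V \<Longrightarrow> b x y = 0 \<Longrightarrow> g x y = 0"
    and fin: "(\<lambda>(x, y). (norm (g x y))\<^sup>2 / b x y) summable_on V \<times> V"
    and div: "(\<lambda>x. norm (\<Sum>\<^sub>\<infinity>y\<in>V. g x y)) summable_on V"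
  shows "(\<Sum>\<^sub>\<infinity>x\<in>V. \<Sum>\<^sub>\<infinity>y\<in>V. g x y) = 0"
proof -
  obtain \<phi> where \<phi>: "\<And>n. finite_support (\<phi> n)" "\<And>n x. 0 \<le> \<phi> n x" "\<And>n x. \<phi> n x \<le> 1"
    "\<And>n. energy (\<phi> n) \<le> (1 / Suc n)\<^sup>2" "\<And>x. x \<in> V \<Longrightarrow> (\<lambda>n. \<phi> n x) \<longlonglongrightarrow> 1"
    using null_sequence[OF p] by metis
  let ?d = "\<lambda>x. \<Sum>\<^sub>\<infinity>y\<in>V. g x y"
  let ?W = "\<lambda>(x, y). (norm (g x y))\<^sup>2 / b x y"
  \<comment> \<open>a weighted inequality of the arithmetic and geometric means replaces Cauchy-Schwarz; later
    \<open>s\<close> is the square root of the energy bound for \<open>\<phi>\<^sub>n\<close>, so that both terms are of order \<open>s\<close>\<close>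
  have amgm: "\<bar>d\<bar> * norm (g x y) \<le> (b x y * d\<^sup>2 / s + s * ((norm (g x y))\<^sup>2 / b x y)) / 2"
    if "x \<in> V" "y \<in> V" "s > 0" for x y d s
  proof (cases "b x y = 0")
    case False
    then have b: "b x y > 0" using b_nonneg[OF that(1,2)] by simp
    have "0 \<le> (b x y * \<bar>d\<bar> - s * norm (g x y))\<^sup>2" by simp
    then have "2 * (b x y * s) * (\<bar>d\<bar> * norm (g x y)) \<le> (b x y)\<^sup>2 * d\<^sup>2 + s\<^sup>2 * (norm (g x y))\<^sup>2"
      by (simp add: power2_diff power_mult_distrib algebra_simps)
    then show ?thesis using b that(3) by (simp add: field_simps power2_eq_square)
  qed (simp add: supp that)
  have row: "(\<lambda>y. norm (g x y)) summable_on V" if x: "x \<in> V" for x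
  proof (rule summable_on_comparison_test)
    have "(\<lambda>y. ?W (x, y)) summable_on V"
      using summable_on_SigmaD1[of "\<lambda>x y. ?W (x, y)" V "\<lambda>_. V" x] fin x b_nonneg
      by (auto simp: case_prod_unfold)
    then show "(\<lambda>y. (b x y + ?W (x, y)) / 2) summable_on V"
      unfolding divide_inverse[of _ "2::real"] by (intro summable_on_cmult_left summable_on_add b_summable x)
  qed (use amgm[OF x, of _ 1 1] in auto)
  have "(\<lambda>n. \<Sum>\<^sub>\<infinity>x\<in>V. \<phi> n x *\<^sub>R ?d x) \<longlonglongrightarrow> infsum ?d V"
  proof (rule tendsto_infsum_dominated[OF _ _ div])
    fix n x assume "x \<in> V"
    then show "(\<lambda>n. \<phi> n x *\<^sub>R ?d x) \<longlonglongrightarrow> ?d x"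
      using tendsto_scaleR[OF \<phi>(5) tendsto_const, of x "?d x"] by simp
    show "norm (\<phi> n x *\<^sub>R ?d x) \<le> norm (?d x)"
      using \<phi>(2,3)[of n x] by (simp add: mult_left_le_one_le)
  qed
  moreover have "(\<lambda>n. \<Sum>\<^sub>\<infinity>x\<in>V. \<phi> n x *\<^sub>R ?d x) \<longlonglongrightarrow> 0"
  proof (rule Lim_null_comparison)
    let ?r = "\<lambda>n. (1 / Suc n) * ((1 + infsum ?W (V \<times> V)) / 4)"
    have "norm (\<Sum>\<^sub>\<infinity>x\<in>V. \<phi> n x *\<^sub>R ?d x) \<le> ?r n" for n
    proof -
      let ?s = "1 / real (Suc n)"
      let ?E = "\<lambda>(x, y). b x y * (\<phi> n x - \<phi> n y) * (\<phi> n x - \<phi> n y)"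
      have "norm (2 *\<^sub>R (\<Sum>\<^sub>\<infinity>x\<in>V. \<phi> n x *\<^sub>R ?d x)) \<le> (energy (\<phi> n) / ?s + ?s * infsum ?W (V \<times> V)) / 2"
      proof (rule norm_infsum_le[OF Green[OF \<phi>(1) anti row]])
        show "((\<lambda>q. (?E q / ?s + ?s * ?W q) / 2) has_sum (energy (\<phi> n) / ?s + ?s * infsum ?W (V \<times> V)) / 2) (V \<times> V)"
          unfolding divide_inverse energy_form_def
          by (intro has_sum_cmult_left has_sum_add has_sum_cmult_right has_sum_infsum
               energy_form_summable[OF \<phi>(1) \<phi>(1), of n, unfolded divide_inverse] fin[unfolded divide_inverse])
        fix q assume "q \<in> V \<times> V"
        then show "norm (case q of (x, y) \<Rightarrow> (\<phi> n x - \<phi> n y) *\<^sub>R g x y) \<le> (?E q / ?s + ?s * ?W q) / 2"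
        proof (elim SigmaE)
          fix x y assume xy: "x \<in> V" "y \<in> V" "q = (x, y)"
          show ?thesis
            using amgm[OF xy(1,2), of ?s "\<phi> n x - \<phi> n y"] unfolding xy(3)
            by (simp only: prod.case norm_scaleR power2_eq_square mult.assoc) simp
        qed
      qed auto
      also have "\<dots> \<le> (?s\<^sup>2 / ?s + ?s * infsum ?W (V \<times> V)) / 2"
        by (intro divide_right_mono add_right_mono \<phi>(4)) auto
      also have "?s\<^sup>2 / ?s = ?s" by (simp add: power2_eq_square)
      finally show ?thesis by (simp add: field_simps)
    qed
    then show "\<forall>\<^sub>F n in sequentially. norm (\<Sum>\<^sub>\<infinity>x\<in>V. \<phi> n x *\<^sub>R ?d x) \<le> ?r n" by simp
    show "?r \<longlonglongrightarrow> 0"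
      using tendsto_mult_right[OF LIMSEQ_inverse_real_of_nat, of "(1 + infsum ?W (V \<times> V)) / 4"]
      by (simp only: inverse_eq_divide mult_zero_left)
  qed
  ultimately show ?thesis by (rule LIMSEQ_unique)
qed

text \<open>
  A Caccioppoli estimate. Testing the inequality for \<open>k\<close> with \<open>\<phi>\<^sup>2 k\<close>, where \<open>\<phi>\<close> is a member of a
  null sequence, shows that \<open>\<phi> k\<close> has at most the energy of \<open>\<phi>\<close>. In the limit \<open>k\<close> has energy 0.
  The factor \<open>k x\<close> in the hypothesis stems from the test function; it admits a minimum of \<open>k\<close> at a zero,
  such as the target vertex of the escape probabilities.
\<close>

lemma bounded_subharmonic_constant:
  assumes p: "p \<in> V" "capacity p = 0"
    and k: "\<And>x. 0 \<le> k x" "\<And>x. k x \<le> 1" "\<And>x. x \<in> V \<Longrightarrow> k x * laplacian k x \<le> 0"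
    and xy: "x \<in> V" "y \<in> V"
  shows "k x = k y"
proof -
  obtain \<phi> where \<phi>: "\<And>n. finite_support (\<phi> n)" "\<And>n x. 0 \<le> \<phi> n x" "\<And>n x. \<phi> n x \<le> 1"
    "\<And>n. energy (\<phi> n) \<le> (1 / Suc n)\<^sup>2" "\<And>x. x \<in> V \<Longrightarrow> (\<lambda>n. \<phi> n x) \<longlonglongrightarrow> 1"
    using null_sequence[OF p] by metis
  have bd: "\<forall>x. \<bar>k x\<bar> \<le> 1" using k by simp
  have le: "energy (\<lambda>x. \<phi> n x * k x) \<le> energy (\<phi> n)" for n
  proof -
    let ?f = "\<lambda>\<phi> \<psi> (x, y). b x y * (\<phi> x - \<phi> y) * (\<psi> x - \<psi> y)"
    let ?\<psi> = "\<lambda>x. (\<phi> n x)\<^sup>2 * k x" and ?\<chi> = "\<lambda>x. \<phi> n x * k x"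
    have fs: "finite_support ?\<psi>" "finite_support ?\<chi>"
      by (rule finite_support_subset[OF \<phi>(1)[of n]]; simp)+
    have "energy_form k ?\<psi> \<le> 0"
    proof -
      have "energy_form k ?\<psi> = 2 * (\<Sum>\<^sub>\<infinity>x\<in>V. ?\<psi> x * laplacian k x)"
        using energy_form_has_sum[OF bd fs(1)] by (simp add: energy_form_def infsumI)
      also have "(\<Sum>\<^sub>\<infinity>x\<in>V. ?\<psi> x * laplacian k x) \<le> 0"
      proof -
        have "0 \<le> - (?\<psi> x * laplacian k x)" if "x \<in> V" for x
          using mult_nonneg_nonpos[OF _ k(3)[OF that], of "(\<phi> n x)\<^sup>2"] by (simp add: mult.assoc)
        then have "0 \<le> (\<Sum>\<^sub>\<infinity>x\<in>V. - (?\<psi> x * laplacian k x))" by (rule infsum_nonneg)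
        then show ?thesis by (simp add: infsum_uminus)
      qed
      finally show ?thesis by simp
    qed
    moreover have "energy ?\<chi> \<le> energy_form k ?\<psi> + energy (\<phi> n)"
    proof -
      have s: "?f k ?\<psi> summable_on V \<times> V" using energy_form_has_sum[OF bd fs(1)] by (rule has_sum_imp_summable)
      have "energy ?\<chi> \<le> (\<Sum>\<^sub>\<infinity>q\<in>V \<times> V. ?f k ?\<psi> q + ?f (\<phi> n) (\<phi> n) q)"
        unfolding energy_form_def
      proof (rule infsum_mono[OF energy_form_summable[OF fs(2,2)] summable_on_add[OF s energy_form_summable[OF \<phi>(1) \<phi>(1)]]], clarify)
        fix x y assume xy: "x \<in> V" "y \<in> V"
        \<comment> \<open>the square of the increment of \<open>\<phi> k\<close> equals the product of the increments of \<open>k\<close> and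
          \<open>\<phi>\<^sup>2 k\<close> plus \<open>k x * k y\<close> times the square of the increment of \<open>\<phi>\<close>\<close>
        have "k x * k y \<le> 1" using k by (simp add: mult_le_one)
        then have "b x y * (\<phi> n x - \<phi> n y)\<^sup>2 * (k x * k y) \<le> b x y * (\<phi> n x - \<phi> n y)\<^sup>2"
          using b_nonneg[OF xy] by (simp add: mult_left_le)
        then show "b x y * (\<phi> n x * k x - \<phi> n y * k y) * (\<phi> n x * k x - \<phi> n y * k y) \<le>
          b x y * (k x - k y) * ((\<phi> n x)\<^sup>2 * k x - (\<phi> n y)\<^sup>2 * k y) + b x y * (\<phi> n x - \<phi> n y) * (\<phi> n x - \<phi> n y)"
          by (simp add: algebra_simps power2_eq_square)
      qed
      also have "\<dots> = energy_form k ?\<psi> + energy (\<phi> n)"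
        unfolding energy_form_def by (rule infsum_add[OF s energy_form_summable[OF \<phi>(1) \<phi>(1)]])
      finally show ?thesis .
    qed
    ultimately show ?thesis by simp
  qed
  show "k x = k y"
  proof (rule connected_induct[OF xy])
    fix y z assume yz: "y \<in> V" "z \<in> V" "b y z > 0" and IH: "k x = k y"
    have "(\<lambda>n. b y z * (\<phi> n y * k y - \<phi> n z * k z)\<^sup>2) \<longlonglongrightarrow> b y z * (1 * k y - 1 * k z)\<^sup>2"
      by (intro tendsto_intros \<phi>(5) yz)
    moreover have "(\<lambda>n. b y z * (\<phi> n y * k y - \<phi> n z * k z)\<^sup>2) \<longlonglongrightarrow> 0"
    proof (rule tendsto_sandwich[OF _ _ tendsto_const])
      have "b y z * (\<phi> n y * k y - \<phi> n z * k z)\<^sup>2 \<le> (1 / Suc n)\<^sup>2" for n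
        using edge_le_energy[OF finite_support_subset[OF \<phi>(1)[of n], of "\<lambda>x. \<phi> n x * k x"] yz(1,2)] le[of n] \<phi>(4)[of n]
        by simp
      then show "\<forall>\<^sub>F n in sequentially. b y z * (\<phi> n y * k y - \<phi> n z * k z)\<^sup>2 \<le> (1 / Suc n)\<^sup>2" by simp
      show "(\<lambda>n. (1 / real (Suc n))\<^sup>2) \<longlonglongrightarrow> 0"
        using tendsto_power[OF LIMSEQ_inverse_real_of_nat, of 2] by (simp add: inverse_eq_divide)
    qed (use yz(3) in auto)
    ultimately have "b y z * (1 * k y - 1 * k z)\<^sup>2 = 0" by (rule LIMSEQ_unique)
    then show "k x = k z" using yz(3) IH by simp
  qed simp
qed

end

section \<open>The random walk on a weighted graph\<close>

text \<open>
  A connected graph with more than one vertex has positive vertex degrees, so that its transition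
  probabilities are defined.
\<close>

locale nontrivial_graph = weighted_graph +
  assumes not_singleton: "\<nexists>v. V = {v}"
begin

definition deg :: "'a \<Rightarrow> real" where "deg x = (\<Sum>\<^sub>\<infinity>z\<in>V. b x z)"

abbreviation p :: "'a \<Rightarrow> 'a \<Rightarrow> real" where "p \<equiv> transition V b"

lemma deg_pos: assumes x: "x \<in> V" shows "deg x > 0"
proof -
  obtain y where y: "y \<in> V" "y \<noteq> x" using x not_singleton by blast
  from connected[OF x y(1)] y(2) obtain z where z: "z \<in> V" "b x z > 0"
    by (auto elim: converse_rtranclE)
  have "b x z \<le> deg x"
    unfolding deg_def using finite_sum_le_infsum[OF b_summable[OF x], of "{z}"] z b_nonneg[OF x] by auto
  with z show ?thesis by simp
qed

lemma transition_eq: "p x y = b x y * inverse (deg x)"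
  by (simp add: transition_def deg_def divide_inverse)

lemma transition_nonneg: "x \<in> V \<Longrightarrow> y \<in> V \<Longrightarrow> p x y \<ge> 0"
  using deg_pos[of x] b_nonneg[of x y] by (simp add: transition_eq)

lemma transition_has_sum: assumes x: "x \<in> V" shows "(p x has_sum 1) V"
proof -
  have "((\<lambda>y. b x y * inverse (deg x)) has_sum deg x * inverse (deg x)) V"
    unfolding deg_def by (intro has_sum_cmult_left has_sum_infsum b_summable x)
  then show ?thesis using deg_pos[OF x] by (simp add: transition_eq[abs_def])
qed

lemma transition_mult_summable:
  assumes "x \<in> V" "A \<subseteq> V" "\<And>y. y \<in> V \<Longrightarrow> \<bar>k y\<bar> \<le> B"
  shows "(\<lambda>y. p x y * k y) summable_on A"
proof -
  have "(\<lambda>y. norm (p x y * k y)) summable_on V"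
  proof (rule Infinite_Sum.abs_summable_on_comparison_test')
    show "(\<lambda>y. p x y * B) summable_on V"
      using has_sum_imp_summable[OF transition_has_sum[OF assms(1)]] by (rule summable_on_cmult_left)
    show "norm (p x y * k y) \<le> p x y * B" if "y \<in> V" for y
      using assms(3)[OF that] transition_nonneg[OF assms(1) that] by (simp add: abs_mult mult_left_mono)
  qed
  then have "(\<lambda>y. p x y * k y) summable_on V" by (rule abs_summable_summable)
  then show ?thesis using assms(2) by (rule summable_on_subset_banach)
qed

lemma transition_sum_remove:
  assumes "x \<in> V" "y \<in> V" "\<And>y. y \<in> V \<Longrightarrow> \<bar>k y\<bar> \<le> B"
  shows "(\<Sum>\<^sub>\<infinity>z\<in>V. p x z * k z) = p x y * k y + (\<Sum>\<^sub>\<infinity>z\<in>V - {y}. p x z * k z)"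
proof -
  have "(\<lambda>z. p x z * k z) summable_on V - {y}"
    by (rule transition_mult_summable[OF assms(1) _ assms(3)]) auto
  from infsum_Un_disjoint[of "\<lambda>z. p x z * k z" "{y}" "V - {y}", OF _ this] show ?thesis
    using assms(2) by (simp add: insert_absorb)
qed

lemma laplacian_eq:
  assumes "x \<in> V" "\<forall>x. \<bar>u x\<bar> \<le> B"
  shows "laplacian u x = deg x * (u x - (\<Sum>\<^sub>\<infinity>z\<in>V. p x z * u z))"
proof -
  have "((\<lambda>z. deg x * (p x z * u x - p x z * u z)) has_sum
      deg x * (1 * u x - (\<Sum>\<^sub>\<infinity>z\<in>V. p x z * u z))) V"
    by (intro has_sum_cmult_right has_sum_diff has_sum_cmult_left has_sum_infsum transition_has_sum
        transition_mult_summable[OF assms(1) order_refl, of _ B] assms(1) assms(2)[rule_format])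
  also have "(\<lambda>z. deg x * (p x z * u x - p x z * u z)) = (\<lambda>z. b x z * (u x - u z))"
    using deg_pos[OF assms(1)] by (auto simp: transition_eq field_simps)
  finally show ?thesis unfolding laplacian_def by (simp add: infsumI)
qed

text \<open>
  The probability that the walk from \<open>x\<close> is not at \<open>y\<close> at any of the times \<open>1,\<dots>,n\<close>, by
  conditioning on the first step.
\<close>

primrec avoid :: "'a \<Rightarrow> nat \<Rightarrow> 'a \<Rightarrow> real" where
  "avoid y 0 x = 1"
| "avoid y (Suc n) x = (\<Sum>\<^sub>\<infinity>z\<in>V - {y}. p x z * avoid y n z)"

lemma avoid_bounds: "x \<in> V \<Longrightarrow> 0 \<le> avoid y n x \<and> avoid y n x \<le> 1"
proof (induction n arbitrary: x)
  case (Suc n)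
  have "0 \<le> avoid y (Suc n) x"
    using Suc transition_nonneg by (auto intro!: infsum_nonneg)
  moreover have "avoid y (Suc n) x \<le> infsum (p x) V"
    unfolding avoid.simps
    by (rule infsum_mono_neutral)
       (use transition_mult_summable[OF Suc.prems, of "V - {y}" "avoid y n" 1] Suc transition_nonneg
         has_sum_imp_summable[OF transition_has_sum] in \<open>auto intro: mult_left_le\<close>)
  ultimately show ?case using transition_has_sum[OF Suc.prems] by (simp add: infsumI)
qed simp

lemma avoid_abs: "x \<in> V \<Longrightarrow> \<bar>avoid y n x\<bar> \<le> 1"
  using avoid_bounds[of x y n] by simp

lemma avoid_decreasing: "x \<in> V \<Longrightarrow> avoid y (Suc n) x \<le> avoid y n x"
proof (induction n arbitrary: x)
  case 0
  then show ?case using avoid_bounds[of x y "Suc 0"] by simp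
next
  case (Suc n)
  show ?case
    unfolding avoid.simps(2)[of y "Suc n"] avoid.simps(2)[of y n x]
    by (rule infsum_mono[OF transition_mult_summable[OF Suc.prems] transition_mult_summable[OF Suc.prems]])
       (use Suc transition_nonneg avoid_abs in \<open>auto intro!: mult_left_mono simp del: avoid.simps\<close>)
qed

text \<open>
  The probability of never visiting \<open>y\<close> at a positive time.
\<close>

definition escape :: "'a \<Rightarrow> 'a \<Rightarrow> real" where
  "escape y x = lim (\<lambda>n. avoid y n x)"

lemma avoid_tendsto_escape: assumes x: "x \<in> V" shows "(\<lambda>n. avoid y n x) \<longlonglongrightarrow> escape y x"
proof -
  have "decseq (\<lambda>n. avoid y n x)" using avoid_decreasing[OF x] by (rule decseq_SucI)
  then have "convergent (\<lambda>n. avoid y n x)"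
    by (rule decseq_convergent[of _ 0]) (use avoid_bounds[OF x] in \<open>auto simp: convergent_def\<close>)
  then show ?thesis by (simp add: escape_def convergent_LIMSEQ_iff)
qed

lemma escape_bounds: "x \<in> V \<Longrightarrow> 0 \<le> escape y x \<and> escape y x \<le> 1"
  using LIMSEQ_le_const[OF avoid_tendsto_escape, of x 0 y] LIMSEQ_le_const2[OF avoid_tendsto_escape, of x y 1]
    avoid_bounds by blast

lemma escape_eq: assumes x: "x \<in> V" shows "escape y x = (\<Sum>\<^sub>\<infinity>z\<in>V - {y}. p x z * escape y z)"
proof (rule LIMSEQ_unique)
  show "(\<lambda>n. avoid y (Suc n) x) \<longlonglongrightarrow> escape y x" using avoid_tendsto_escape[OF x] by (rule LIMSEQ_Suc)
  show "(\<lambda>n. avoid y (Suc n) x) \<longlonglongrightarrow> (\<Sum>\<^sub>\<infinity>z\<in>V - {y}. p x z * escape y z)"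
    unfolding avoid.simps
  proof (rule tendsto_infsum_dominated)
    show "(\<lambda>n. p x z * avoid y n z) \<longlonglongrightarrow> p x z * escape y z" if "z \<in> V - {y}" for z
      using that by (intro tendsto_intros avoid_tendsto_escape) auto
    show "norm (p x z * avoid y n z) \<le> p x z" if "z \<in> V - {y}" for z n
      using that transition_nonneg[OF x, of z] avoid_abs[of z y n] by (simp add: abs_mult mult_left_le)
    show "p x summable_on V - {y}"
      using has_sum_imp_summable[OF transition_has_sum[OF x]] by (rule summable_on_subset_banach) auto
  qed
qed

text \<open>
  As a function of the starting vertex, the probability of never visiting \<open>y\<close> at any time, including
  time 0, is harmonic off \<open>y\<close> and zero at \<open>y\<close>. Hence it is constant, and the constant is 0. The
  starting vertex \<open>y\<close> itself is then covered by one step of the walk.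
\<close>

lemma escape_zero_if_capacity_zero:
  assumes q: "q \<in> V" "capacity q = 0" and xy: "x \<in> V" "y \<in> V"
  shows "escape y x = 0"
proof -
  define k where "k z = (if z \<in> V \<and> z \<noteq> y then escape y z else 0)" for z
  have k: "0 \<le> k z" "k z \<le> 1" for z using escape_bounds by (auto simp: k_def)
  then have k_abs: "\<forall>z. \<bar>k z\<bar> \<le> 1" by simp
  have mean: "escape y z = (\<Sum>\<^sub>\<infinity>w\<in>V. p z w * k w)" if z: "z \<in> V" for z
    unfolding escape_eq[OF z] by (rule infsum_cong_neutral) (auto simp: k_def)
  have sub: "k z * laplacian k z \<le> 0" if z: "z \<in> V" for z
    using laplacian_eq[OF z k_abs] mean[OF z] z by (cases "z = y") (simp_all add: k_def[of y] k_def[of z])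
  have "k z = 0" if "z \<in> V" for z
  proof -
    have "k z = k y"
      by (rule bounded_subharmonic_constant[where k = k, OF q]) (fact k sub that xy)+
    then show ?thesis by (simp add: k_def[of y])
  qed
  then have "(\<Sum>\<^sub>\<infinity>w\<in>V. p x w * k w) = 0" by (intro infsum_0) auto
  then show ?thesis using mean[OF xy(1)] by simp
qed

text \<open>
  The supermartingale inequality: \<open>u x\<close> is at least the expected value of \<open>u\<close> at the time of the first
  visit to \<open>y\<close>, as far as this visit happens within \<open>n\<close> steps.
\<close>

lemma superharmonic_ge_hitting:
  assumes u: "\<And>x. 0 \<le> u x" "\<And>x. u x \<le> 1" "\<And>x. x \<in> V \<Longrightarrow> laplacian u x \<ge> 0"
    and y: "y \<in> V"
  shows "x \<in> V \<Longrightarrow> u y * (1 - avoid y n x) \<le> u x"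
proof (induction n arbitrary: x)
  case (Suc n)
  have u_abs: "\<bar>u z\<bar> \<le> 1" for z using u by simp
  have h_abs: "\<bar>u y * (1 - avoid y n z)\<bar> \<le> 1" if "z \<in> V" for z
    using avoid_bounds[OF that, of y n] u by (simp add: abs_mult mult_le_one)
  have "p x y * u y + (\<Sum>\<^sub>\<infinity>z\<in>V - {y}. p x z * (u y * (1 - avoid y n z)))
      \<le> p x y * u y + (\<Sum>\<^sub>\<infinity>z\<in>V - {y}. p x z * u z)"
    by (intro add_left_mono infsum_mono transition_mult_summable[OF Suc.prems _ u_abs]
        transition_mult_summable[OF Suc.prems _ h_abs] mult_left_mono Suc.IH transition_nonneg Suc.prems) auto
  also have "\<dots> = (\<Sum>\<^sub>\<infinity>z\<in>V. p x z * u z)"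
    using transition_sum_remove[OF Suc.prems y u_abs] by simp
  also have "\<dots> \<le> u x"
    using u(3)[OF Suc.prems] laplacian_eq[OF Suc.prems, of u 1] u_abs deg_pos[OF Suc.prems]
    by (simp add: zero_le_mult_iff)
  finally have le: "p x y * u y + (\<Sum>\<^sub>\<infinity>z\<in>V - {y}. p x z * (u y * (1 - avoid y n z))) \<le> u x" .
  have "((\<lambda>z. u y * (p x z * 1 - p x z * avoid y n z)) has_sum
      u y * ((\<Sum>\<^sub>\<infinity>z\<in>V - {y}. p x z * 1) - avoid y (Suc n) x)) (V - {y})"
    unfolding avoid.simps
    by (intro has_sum_cmult_right has_sum_diff has_sum_infsum transition_mult_summable[OF Suc.prems]) (auto intro: avoid_abs)
  then have "(\<Sum>\<^sub>\<infinity>z\<in>V - {y}. p x z * (u y * (1 - avoid y n z)))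
      = u y * ((\<Sum>\<^sub>\<infinity>z\<in>V - {y}. p x z * 1) - avoid y (Suc n) x)"
    by (simp add: algebra_simps infsumI)
  moreover have "(\<Sum>\<^sub>\<infinity>z\<in>V - {y}. p x z * 1) = 1 - p x y"
    using transition_sum_remove[OF Suc.prems y, of "\<lambda>_. 1" 1] transition_has_sum[OF Suc.prems] by (simp add: infsumI)
  ultimately have "p x y * u y + u y * (1 - p x y - avoid y (Suc n) x) \<le> u x" using le by metis
  then show ?case by (simp add: algebra_simps del: avoid.simps)
qed (simp add: u)

text \<open>
  If every vertex is reached from every other with probability 1, the supermartingale inequality makes the
  equilibrium potential constant. But then its Laplacian vanishes at the pole as well.
\<close>

lemma capacity_zero_if_escape_zero:
  assumes esc: "\<And>x y. x \<in> V \<Longrightarrow> y \<in> V \<Longrightarrow> escape y x = 0" and q: "q \<in> V"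
  shows "capacity q = 0"
proof (rule ccontr)
  assume cap: "capacity q \<noteq> 0"
  then have pos: "capacity q > 0" using capacity_nonneg[OF q] by simp
  obtain u where "\<forall>x. 0 \<le> u x \<and> u x \<le> 1" "\<forall>x\<in>V. laplacian u x = (if x = q then capacity q / 2 else 0)"
    using equilibrium_potential[OF q] by blast
  then have u: "\<And>x. 0 \<le> u x" "\<And>x. u x \<le> 1"
    "\<And>x. x \<in> V \<Longrightarrow> laplacian u x = (if x = q then capacity q / 2 else 0)"
    by blast+
  have super: "laplacian u x \<ge> 0" if "x \<in> V" for x using u(3)[OF that] pos by simp
  have le: "u y \<le> u x" if xy: "x \<in> V" "y \<in> V" for x y
  proof (rule LIMSEQ_le_const2)
    show "(\<lambda>n. u y * (1 - avoid y n x)) \<longlonglongrightarrow> u y"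
      using tendsto_mult_left[OF tendsto_diff[OF tendsto_const avoid_tendsto_escape[OF xy(1), of y]], of "u y" 1]
      by (simp add: esc xy)
    show "\<exists>N. \<forall>n\<ge>N. u y * (1 - avoid y n x) \<le> u x"
      using superharmonic_ge_hitting[OF u(1,2) super xy(2,1)] by blast
  qed
  have "laplacian u q = 0"
    unfolding laplacian_def by (rule infsum_0) (use le[OF q] le[OF _ q] in \<open>auto intro: antisym\<close>)
  then show False using u(3)[OF q] cap by simp
qed

text \<open>
  The law of the chain is prescribed through histories, so the induction on \<open>n\<close> extends an arbitrary
  history by one step and splits according to the next vertex.
\<close>

lemma markov_chain_avoid:
  fixes M :: "'w measure" and Y :: "nat \<Rightarrow> 'w \<Rightarrow> 'a"
  assumes chain: "markov_chain M V p Y"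
  shows "s k \<in> V \<Longrightarrow>
    \<P>(\<omega> in M. (\<forall>i\<le>k. Y i \<omega> = s i) \<and> (\<forall>j\<in>{k<..k + n}. Y j \<omega> \<noteq> y)) =
    \<P>(\<omega> in M. \<forall>i\<le>k. Y i \<omega> = s i) * avoid y n (s k)"
proof (induction n arbitrary: k s)
  case 0
  then show ?case by simp
next
  case (Suc n)
  interpret prob_space M using chain by (simp add: markov_chain_def)
  have Y[measurable]: "Y n \<in> measurable M (count_space V)" for n using chain by (simp add: markov_chain_def)
  have Y_in: "Y n \<omega> \<in> V" if "\<omega> \<in> space M" for n \<omega> using measurable_space[OF Y that] by simp
  have step: "\<P>(\<omega> in M. \<forall>i\<le>Suc k. Y i \<omega> = (s(Suc k := z)) i) = \<P>(\<omega> in M. \<forall>i\<le>k. Y i \<omega> = s i) * p (s k) z"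
    if z: "z \<in> V" for z
  proof -
    have eq: "\<P>(\<omega> in M. \<forall>i\<le>Suc k. Y i \<omega> = (s(Suc k := z)) i) = \<P>(\<omega> in M. Y (Suc k) \<omega> = z \<and> (\<forall>i\<le>k. Y i \<omega> = s i))"
      by (rule arg_cong[of _ _ prob]) (auto simp: le_Suc_eq)
    \<comment> \<open>the defining property speaks only of histories of positive probability; for the others both
      sides vanish\<close>
    show ?thesis
    proof (cases "\<P>(\<omega> in M. \<forall>i\<le>k. Y i \<omega> = s i) > 0")
      case True
      then have "\<P>(\<omega> in M. Y (Suc k) \<omega> = z \<bar> \<forall>i\<le>k. Y i \<omega> = s i) = p (s k) z"
        using chain z unfolding markov_chain_def by blast
      then show ?thesis using True unfolding cond_prob_def eq by (simp add: field_simps)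
    next
      case False
      then have 0: "\<P>(\<omega> in M. \<forall>i\<le>k. Y i \<omega> = s i) = 0" by (simp add: measure_le_0_iff not_less)
      have "\<P>(\<omega> in M. Y (Suc k) \<omega> = z \<and> (\<forall>i\<le>k. Y i \<omega> = s i)) \<le> \<P>(\<omega> in M. \<forall>i\<le>k. Y i \<omega> = s i)"
        by (rule finite_measure_mono) auto
      then show ?thesis using 0 eq by (simp add: measure_le_0_iff)
    qed
  qed
  let ?E = "\<lambda>z. {\<omega> \<in> space M. (\<forall>i\<le>Suc k. Y i \<omega> = (s(Suc k := z)) i) \<and> (\<forall>j\<in>{Suc k<..Suc k + n}. Y j \<omega> \<noteq> y)}"
  let ?f = "\<lambda>z. \<P>(\<omega> in M. \<forall>i\<le>k. Y i \<omega> = s i) * (p (s k) z * avoid y n z)"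
  have "{\<omega> \<in> space M. (\<forall>i\<le>k. Y i \<omega> = s i) \<and> (\<forall>j\<in>{k<..k + Suc n}. Y j \<omega> \<noteq> y)} = (\<Union>z\<in>V - {y}. ?E z)"
  proof -
    have "{k<..k + Suc n} = insert (Suc k) {Suc k<..Suc k + n}" by auto
    then show ?thesis using Y_in by (auto simp: le_Suc_eq)
  qed
  also have "prob \<dots> = infsum ?f (V - {y})"
  proof (rule measure_UN_countable_infsum)
    show "countable (V - {y})" using countable_V by blast
    show "?E z \<in> events" for z by measurable
    show "disjoint_family_on ?E (V - {y})" by (auto simp: disjoint_family_on_def)
    show "prob (?E z) = ?f z" if "z \<in> V - {y}" for z
      using Suc.IH[of "s(Suc k := z)" "Suc k"] step[of z] that by simp
    show "?f summable_on V - {y}"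
      by (intro summable_on_cmult_right transition_mult_summable[OF Suc.prems]) (auto intro: avoid_abs)
  qed
  also have "\<dots> = \<P>(\<omega> in M. \<forall>i\<le>k. Y i \<omega> = s i) * avoid y (Suc n) (s k)"
    by (simp add: infsum_cmult_right')
  finally show ?case .
qed

lemma markov_chain_return_prob:
  fixes M :: "'w measure" and Y :: "nat \<Rightarrow> 'w \<Rightarrow> 'a"
  assumes chain: "markov_chain M V p Y" and x: "x \<in> V" and start: "\<P>(\<omega> in M. Y 0 \<omega> = x) > 0"
  shows "\<P>(\<omega> in M. \<exists>k>0. Y k \<omega> = y \<bar> Y 0 \<omega> = x) = 1 - escape y x"
proof -
  interpret prob_space M using chain by (simp add: markov_chain_def)
  have Y[measurable]: "Y n \<in> measurable M (count_space V)" for n using chain by (simp add: markov_chain_def)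
  let ?A = "\<lambda>n. {\<omega> \<in> space M. Y 0 \<omega> = x \<and> (\<forall>j\<in>{0<..n}. Y j \<omega> \<noteq> y)}"
  let ?S = "{\<omega> \<in> space M. Y 0 \<omega> = x}"
  let ?B = "{\<omega> \<in> space M. (\<exists>k>0. Y k \<omega> = y) \<and> Y 0 \<omega> = x}"
  have A: "prob (?A n) = prob ?S * avoid y n x" for n
    using markov_chain_avoid[OF chain, of "\<lambda>_. x" 0 n y] x by simp
  have "(\<lambda>n. prob (?A n)) \<longlonglongrightarrow> prob (\<Inter>n. ?A n)"
    by (rule finite_Lim_measure_decseq) (auto simp: decseq_def)
  moreover have "(\<lambda>n. prob (?A n)) \<longlonglongrightarrow> prob ?S * escape y x"
    unfolding A by (intro tendsto_intros avoid_tendsto_escape x)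
  ultimately have lim: "prob (\<Inter>n. ?A n) = prob ?S * escape y x" by (rule LIMSEQ_unique)
  have "(\<Inter>n. ?A n) = ?S - ?B"
  proof (intro set_eqI iffI)
    fix \<omega> assume "\<omega> \<in> (\<Inter>n. ?A n)"
    then have *: "\<omega> \<in> ?A n" for n by blast
    then show "\<omega> \<in> ?S - ?B" by fastforce
  qed (auto, metis less_irrefl)
  then have "prob (\<Inter>n. ?A n) = prob ?S - prob ?B"
    by (simp only:) (rule finite_measure_Diff, measurable, auto)
  with lim start show ?thesis by (simp add: cond_prob_def field_simps)
qed

text \<open>
  Recurrence is a statement about all chains, so it has content only if a chain exists. The
  Ionescu-Tulcea theorem provides one on the space of trajectories: the kernel for time 0 is the point
  mass at \<open>x0\<close>, and each later kernel depends on the last vertex only. The remaining work is to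
  compute the probabilities of finite histories from the kernels.
\<close>

lemma markov_chain_exists:
  assumes x0: "x0 \<in> V"
  shows "\<exists>(M :: (nat \<Rightarrow> 'a) measure) Y. markov_chain M V p Y \<and> \<P>(\<omega> in M. Y 0 \<omega> = x0) > 0"
proof -
  let ?N = "\<lambda>_::nat. count_space V"
  define \<kappa> where "\<kappa> x = density (count_space V) (\<lambda>z. ennreal (p x z))" for x
  define P where "P n \<omega> = (if n = 0 then return (count_space V) x0 else \<kappa> (\<omega> (n - 1)))" for n :: nat and \<omega> :: "nat \<Rightarrow> 'a"
  have \<kappa>_prob: "prob_space (\<kappa> x)" if x: "x \<in> V" for x
  proof
    have "emeasure (\<kappa> x) V = (\<integral>\<^sup>+z. ennreal (p x z) \<partial>count_space V)"
      unfolding \<kappa>_def by (subst emeasure_density) (auto intro!: nn_integral_cong)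
    also have "\<dots> = 1"
      using nn_integral_count_space_infsum[OF has_sum_imp_summable[OF transition_has_sum[OF x]] transition_nonneg[OF x]]
        transition_has_sum[OF x] by (simp add: infsumI)
    finally show "emeasure (\<kappa> x) (space (\<kappa> x)) = 1" by (simp add: \<kappa>_def)
  qed
  have \<kappa>_single: "emeasure (\<kappa> x) {z} = ennreal (p x z)" if "z \<in> V" for x z
    unfolding \<kappa>_def using that by (subst emeasure_density) auto
  have \<kappa>_meas: "\<kappa> \<in> measurable (count_space V) (subprob_algebra (count_space V))"
  proof -
    have "sets (\<kappa> x) = Pow V" for x by (simp add: \<kappa>_def)
    then show ?thesis by (simp add: space_subprob_algebra \<kappa>_prob prob_space_imp_subprob_space)
  qed
  have P_meas: "P n \<in> measurable (PiM {0..<n} ?N) (subprob_algebra (?N n))" for n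
  proof (cases n)
    case 0
    have "return (count_space V) x0 \<in> space (subprob_algebra (count_space V))"
      using x0 by (simp add: space_subprob_algebra prob_space_imp_subprob_space prob_space_return)
    then show ?thesis unfolding P_def 0 by simp
  next
    case (Suc k)
    have "(\<lambda>\<omega>. \<omega> k) \<in> measurable (PiM {0..<Suc k} ?N) (count_space V)"
      by (rule measurable_component_singleton) simp
    from measurable_compose[OF this \<kappa>_meas] show ?thesis unfolding P_def Suc by simp
  qed
  have P_prob: "prob_space (P n \<omega>)" if "\<omega> \<in> space (PiM {0..<n} ?N)" for n \<omega>
  proof (cases n)
    case 0
    then show ?thesis using x0 by (simp add: P_def prob_space_return)
  next
    case (Suc k)
    then have "\<omega> k \<in> V" using that by (auto simp: space_PiM)
    then show ?thesis using Suc by (simp add: P_def \<kappa>_prob)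
  qed
  interpret IT: Ionescu_Tulcea P ?N by (rule Ionescu_Tulcea.intro; fact P_meas P_prob)
  let ?M = "IT.PF.lim"
  let ?u = "\<lambda>_. undefined :: 'a"
  have u_space: "?u \<in> space (PiM {0..<0} ?N)" by (simp add: space_PiM)
  have single_sets: "{restrict s {0..<n}} \<in> sets (PiM {0..<n} ?N)" if "\<And>i. s i \<in> V" for s :: "nat \<Rightarrow> 'a" and n
  proof -
    have "{restrict s {0..<n}} = PiE {0..<n} (\<lambda>i. {restrict s {0..<n} i})"
      by (rule PiE_singleton[symmetric]) simp
    also have "\<dots> = PiE {0..<n} (\<lambda>i. {s i})" by (rule PiE_cong) simp
    also have "PiE {0..<n} (\<lambda>i. {s i}) \<in> sets (PiM {0..<n} ?N)" by (rule sets_PiM_I_finite) (use that in auto)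
    finally show ?thesis .
  qed
  have C_step: "emeasure (IT.C 0 (Suc n) ?u) {restrict s {0..<Suc n}}
      = emeasure (IT.C 0 n ?u) {restrict s {0..<n}} * emeasure (P n (restrict s {0..<n})) {s n}"
    if s: "\<And>i. s i \<in> V" for s n
  proof -
    have sp: "space (IT.C 0 n ?u) = space (PiM {0..<n} ?N)" using IT.space_C[OF u_space, of n] by simp
    have st: "sets (IT.C 0 n ?u) = sets (PiM {0..<n} ?N)" using IT.sets_C[OF u_space, of n] by simp
    have "emeasure (IT.C 0 (Suc n) ?u) {restrict s {0..<Suc n}}
       = (\<integral>\<^sup>+\<omega>. emeasure (IT.eP n \<omega>) {restrict s {0..<Suc n}} \<partial>IT.C 0 n ?u)"
      unfolding IT.C.simps add_0
    proof (rule emeasure_bind)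
      show "space (IT.C 0 n ?u) \<noteq> {}" unfolding sp using s by (auto simp: space_PiM PiE_eq_empty_iff)
      show "IT.eP n \<in> measurable (IT.C 0 n ?u) (subprob_algebra (PiM {0..<Suc n} ?N))"
        using IT.measurable_eP[of n] by (simp add: measurable_cong_sets[OF st refl])
      show "{restrict s {0..<Suc n}} \<in> sets (PiM {0..<Suc n} ?N)" by (rule single_sets[OF s])
    qed
    also have "\<dots> = (\<integral>\<^sup>+\<omega>. emeasure (P n (restrict s {0..<n})) {s n} * indicator {restrict s {0..<n}} \<omega> \<partial>IT.C 0 n ?u)"
    proof (rule nn_integral_cong)
      fix \<omega> assume "\<omega> \<in> space (IT.C 0 n ?u)"
      then have \<omega>: "\<omega> \<in> space (PiM {0..<n} ?N)" by (simp add: sp)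
      have "fun_upd \<omega> n -` {restrict s {0..<Suc n}} \<inter> V = (if \<omega> = restrict s {0..<n} then {s n} else {})"
      proof -
        have "fun_upd \<omega> n x = restrict s {0..<Suc n} \<longleftrightarrow> \<omega> = restrict s {0..<n} \<and> x = s n" for x
        proof
          assume *: "fun_upd \<omega> n x = restrict s {0..<Suc n}"
          have "\<omega> i = restrict s {0..<n} i" for i
          proof (cases "i < n")
            case True
            then show ?thesis using fun_cong[OF *, of i] by simp
          next
            case False
            then have "\<omega> i = undefined" using \<omega> by (auto simp: space_PiM PiE_def extensional_def)
            then show ?thesis using False by simp
          qed
          then show "\<omega> = restrict s {0..<n} \<and> x = s n" using fun_cong[OF *, of n] by auto
        qed (auto simp: fun_eq_iff)
        then show ?thesis using s by auto
      qed
      then show "emeasure (IT.eP n \<omega>) {restrict s {0..<Suc n}}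
          = emeasure (P n (restrict s {0..<n})) {s n} * indicator {restrict s {0..<n}} \<omega>"
        using IT.emeasure_eP[OF \<omega> single_sets[of s "Suc n", OF s]] by (auto simp: indicator_def)
    qed
    also have "\<dots> = emeasure (P n (restrict s {0..<n})) {s n} * emeasure (IT.C 0 n ?u) {restrict s {0..<n}}"
      by (rule nn_integral_cmult_indicator) (use single_sets[OF s] st in auto)
    finally show ?thesis by (simp add: mult.commute)
  qed
  have emb: "emeasure ?M {\<omega> \<in> space ?M. \<forall>i\<le>n. \<omega> i = s i} = emeasure (IT.C 0 (Suc n) ?u) {restrict s {0..<Suc n}}"
    if s: "\<And>i. s i \<in> V" for s n
  proof -
    have "{\<omega> \<in> space ?M. \<forall>i\<le>n. \<omega> i = s i} = prod_emb UNIV ?N {0..<Suc n} {restrict s {0..<Suc n}}"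
      by (auto simp: prod_emb_def space_PiM fun_eq_iff less_Suc_eq_le restrict_def) metis
    also have "emeasure ?M \<dots> = emeasure (IT.CI {0..<Suc n}) {restrict s {0..<Suc n}}"
      by (rule IT.lim) (use single_sets[OF s] in auto)
    also have "\<dots> = emeasure (IT.C 0 (Suc n) ?u) (prod_emb {0..<Suc n} ?N {0..<Suc n} {restrict s {0..<Suc n}})"
      by (rule IT.emeasure_CI[OF order_refl single_sets[OF s]])
    also have "prod_emb {0..<Suc n} ?N {0..<Suc n} {restrict s {0..<Suc n}} = {restrict s {0..<Suc n}}"
      by (rule prod_emb_id) (use s in auto)
    finally show ?thesis .
  qed
  interpret prob_space ?M
  proof
    have "emeasure ?M (space ?M) = emeasure ?M (prod_emb UNIV ?N {} (space (PiM {} ?N)))"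
      by (rule arg_cong[of _ _ "emeasure ?M"]) (auto simp: prod_emb_def space_PiM)
    also have "\<dots> = emeasure (IT.CI {}) (space (PiM {} ?N))" by (rule IT.lim) auto
    also have "\<dots> = 1"
      using prob_space.emeasure_space_1[OF IT.PF.prob_space_P[of "{}"]] by (simp add: IT.CI_def)
    finally show "emeasure ?M (space ?M) = 1" .
  qed
  have meas: "(\<lambda>\<omega>. \<omega> n) \<in> measurable ?M (count_space V)" for n
    by (simp add: measurable_cong_sets[OF IT.PF.sets_lim refl] measurable_component_singleton)
  note [measurable] = meas
  have in_V: "\<omega> i \<in> V" if "\<omega> \<in> space ?M" for \<omega> i using measurable_space[OF meas that] by simp
  have step: "\<P>(\<omega> in ?M. \<forall>i\<le>Suc n. \<omega> i = s i) = \<P>(\<omega> in ?M. \<forall>i\<le>n. \<omega> i = s i) * p (s n) (s (Suc n))"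
    if s: "\<And>i. s i \<in> V" for s n
  proof -
    have "emeasure ?M {\<omega> \<in> space ?M. \<forall>i\<le>Suc n. \<omega> i = s i} = emeasure ?M {\<omega> \<in> space ?M. \<forall>i\<le>n. \<omega> i = s i} * ennreal (p (s n) (s (Suc n)))"
      unfolding emb[OF s] C_step[OF s, of "Suc n"] by (simp add: P_def \<kappa>_single s)
    then show ?thesis using transition_nonneg[OF s s] by (simp add: emeasure_eq_measure ennreal_mult[symmetric])
  qed
  have "markov_chain ?M V p (\<lambda>n \<omega>. \<omega> n)"
    unfolding markov_chain_def
  proof (intro conjI allI ballI impI)
    show "prob_space ?M" by (rule prob_space_axioms)
    show "(\<lambda>\<omega>. \<omega> n) \<in> measurable ?M (count_space V)" for n by (rule meas)
    fix n s y assume y: "y \<in> V" and pos: "0 < \<P>(\<omega> in ?M. \<forall>i\<le>n. \<omega> i = s i)"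
    have sV: "s i \<in> V" if "i \<le> n" for i
    proof (rule ccontr)
      assume "s i \<notin> V"
      moreover have "s i \<in> V" if "\<omega> \<in> {\<omega> \<in> space ?M. \<forall>i\<le>n. \<omega> i = s i}" for \<omega>
      proof -
        have "\<omega> \<in> space ?M" "\<omega> i = s i" using that \<open>i \<le> n\<close> by blast+
        then show ?thesis using in_V[of \<omega> i] by metis
      qed
      ultimately have "{\<omega> \<in> space ?M. \<forall>i\<le>n. \<omega> i = s i} = {}" by blast
      then show False using pos by (metis less_irrefl measure_empty)
    qed
    \<comment> \<open>the step formula is for sequences that stay in \<open>V\<close>, and \<open>s\<close> may leave it after time \<open>n\<close>\<close>
    define s' where "s' i = (if i \<le> n then s i else y)" for i
    have s': "s' i \<in> V" for i using sV y by (simp add: s'_def)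
    have "\<P>(\<omega> in ?M. \<omega> (Suc n) = y \<and> (\<forall>i\<le>n. \<omega> i = s i)) = \<P>(\<omega> in ?M. \<forall>i\<le>Suc n. \<omega> i = s' i)"
      by (rule arg_cong[of _ _ prob]) (auto simp: s'_def le_Suc_eq)
    also have "\<dots> = \<P>(\<omega> in ?M. \<forall>i\<le>n. \<omega> i = s' i) * p (s' n) (s' (Suc n))" by (rule step[OF s'])
    also have "\<dots> = \<P>(\<omega> in ?M. \<forall>i\<le>n. \<omega> i = s i) * p (s n) y" by (simp add: s'_def)
    finally show "\<P>(\<omega> in ?M. \<omega> (Suc n) = y \<bar> \<forall>i\<le>n. \<omega> i = s i) = p (s n) y"
      using pos by (simp add: cond_prob_def)
  qed
  moreover have "\<P>(\<omega> in ?M. \<omega> 0 = x0) > 0"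
  proof -
    have "emeasure ?M {\<omega> \<in> space ?M. \<forall>i\<le>0. \<omega> i = x0} = 1"
      unfolding emb[of "\<lambda>_. x0", OF x0] C_step[of "\<lambda>_. x0", OF x0]
      using x0 by (simp add: P_def restrict_def sets_PiM_empty)
    then show ?thesis by (simp add: emeasure_eq_measure)
  qed
  ultimately show ?thesis by blast
qed

lemma recurrent_iff_capacity_zero: "recurrent_graph V b \<longleftrightarrow> (\<forall>q\<in>V. capacity q = 0)"
proof
  assume rec: "recurrent_graph V b"
  have "escape y x = 0" if xy: "x \<in> V" "y \<in> V" for x y
  proof -
    obtain M :: "(nat \<Rightarrow> 'a) measure" and Y where Y: "markov_chain M V p Y" "\<P>(\<omega> in M. Y 0 \<omega> = x) > 0"
      using markov_chain_exists[OF xy(1)] by blast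
    then have "\<P>(\<omega> in M. \<exists>k>0. Y k \<omega> = y \<bar> Y 0 \<omega> = x) = 1"
      using rec not_singleton xy unfolding recurrent_graph_def by blast
    then show ?thesis using markov_chain_return_prob[OF Y(1) xy(1) Y(2), of y] by simp
  qed
  then show "\<forall>q\<in>V. capacity q = 0" using capacity_zero_if_escape_zero by blast
next
  assume "\<forall>q\<in>V. capacity q = 0"
  then have "escape y x = 0" if "x \<in> V" "y \<in> V" for x y
    using escape_zero_if_capacity_zero that by blast
  then show "recurrent_graph V b"
    unfolding recurrent_graph_def by (auto simp: markov_chain_return_prob)
qed

end

section \<open>Links of a weighted simplicial complex\<close>

lemma connected_component:
  assumes sym: "\<And>x y. x \<in> V \<Longrightarrow> y \<in> V \<Longrightarrow> b x y = b y x"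
    and C: "C \<in> connected_components_graph V (b :: 'a \<Rightarrow> 'a \<Rightarrow> real)"
  shows component_subset: "C \<subseteq> V"
    and component_nonempty: "C \<noteq> {}"
    and component_closed: "\<And>x y. x \<in> C \<Longrightarrow> y \<in> V \<Longrightarrow> b x y > 0 \<Longrightarrow> y \<in> C"
    and component_connected: "\<And>x y. x \<in> C \<Longrightarrow> y \<in> C \<Longrightarrow> (x, y) \<in> {(x, y). x \<in> C \<and> y \<in> C \<and> b x y > 0}\<^sup>*"
    and component_eq: "\<And>x. x \<in> C \<Longrightarrow> C = {(x, y). x \<in> V \<and> y \<in> V \<and> b x y > 0}\<^sup>* `` {x}"
proof -
  let ?R = "{(x, y). x \<in> V \<and> y \<in> V \<and> b x y > 0}"
  let ?Q = "{(x, y). x \<in> C \<and> y \<in> C \<and> b x y > 0}"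
  obtain r where r: "r \<in> V" "C = ?R\<^sup>* `` {r}"
    using C unfolding connected_components_graph_def by (auto elim: quotientE)
  show sub: "C \<subseteq> V" 
  proof
    fix y assume "y \<in> C"
    then have "(r, y) \<in> ?R\<^sup>*" using r by auto
    then show "y \<in> V" by (induction rule: rtrancl_induct) (use r in auto)
  qed
  show "C \<noteq> {}" using r by auto
  show closed: "y \<in> C" if "x \<in> C" "y \<in> V" "b x y > 0" for x y
    using that sub unfolding r(2) by (auto intro: rtrancl_into_rtrancl)
  have reach: "(r, y) \<in> ?Q\<^sup>*" if "y \<in> C" for y
  proof -
    have "(r, y) \<in> ?R\<^sup>*" using r that by auto
    then show ?thesis
    proof (induction rule: rtrancl_induct)
      case (step y z)
      then have "y \<in> C" "z \<in> C" unfolding r(2) by (auto intro: rtrancl_into_rtrancl)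
      then show ?case using step by (auto intro: rtrancl_into_rtrancl)
    qed simp
  qed
  have "sym ?Q"
  proof (rule symI)
    fix x y assume "(x, y) \<in> ?Q"
    then have xy: "x \<in> C" "y \<in> C" "b x y > 0" by auto
    then have "b x y = b y x" using sub by (intro sym) auto
    with xy show "(y, x) \<in> ?Q" by simp
  qed
  then have "sym (?Q\<^sup>*)" by (rule sym_rtrancl)
  then show conn: "(x, y) \<in> ?Q\<^sup>*" if "x \<in> C" "y \<in> C" for x y
    using reach[OF that(1)] reach[OF that(2)] by (meson rtrancl_trans symD)
  have mono: "?Q\<^sup>* \<subseteq> ?R\<^sup>*" using sub by (intro rtrancl_mono) auto
  show "C = ?R\<^sup>* `` {x}" if "x \<in> C" for x
    using that conn mono r(2) by (auto intro: rtrancl_trans)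
qed

locale weighted_complex =
  fixes X :: "'a set" and K :: "'a set set" and m :: "'a set \<Rightarrow> real"
    and \<theta> :: "'a set \<Rightarrow> 'a set \<Rightarrow> complex" and S :: "'a set set"
  assumes wsc: "weighted_simplicial_complex X K m"
    and S_def: "S = simplices X K m"
    and coeffs: "coboundary_coeffs S \<theta>"
begin

lemma simplex:
  assumes "\<sigma> \<in> S"
  shows simplex_finite: "finite \<sigma>" and simplex_subset: "\<sigma> \<subseteq> X" and m_pos: "m \<sigma> > 0"
  using assms wsc unfolding S_def simplices_def weighted_simplicial_complex_def simplicial_complex_def
  by (auto split: if_splits)

lemma subsimplex: "\<sigma> \<in> S \<Longrightarrow> \<tau> \<subseteq> \<sigma> \<Longrightarrow> \<tau> \<noteq> {} \<Longrightarrow> \<tau> \<in> S"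
  using wsc unfolding S_def simplices_def weighted_simplicial_complex_def simplicial_complex_def
  by (auto split: if_splits)

lemma m_summable: "\<rho> \<in> S \<Longrightarrow> m summable_on cofaces S \<rho>"
  using wsc unfolding S_def weighted_simplicial_complex_def by blast

lemma is_face_iff: "is_face \<tau> \<sigma> \<longleftrightarrow> (\<exists>v. v \<notin> \<tau> \<and> \<sigma> = insert v \<tau>)"
proof
  assume f: "is_face \<tau> \<sigma>"
  then obtain v where "\<sigma> - \<tau> = {v}" unfolding is_face_def by (metis card_1_singletonE)
  then show "\<exists>v. v \<notin> \<tau> \<and> \<sigma> = insert v \<tau>" using f unfolding is_face_def by (intro exI[of _ v]) auto
next
  assume "\<exists>v. v \<notin> \<tau> \<and> \<sigma> = insert v \<tau>"
  then obtain v where v: "v \<notin> \<tau>" "\<sigma> = insert v \<tau>" by blast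
  then have "\<sigma> - \<tau> = {v}" by auto
  then show "is_face \<tau> \<sigma>" using v by (auto simp: is_face_def)
qed

lemma is_face_insert: "is_face \<rho> (insert v \<rho>) \<longleftrightarrow> v \<notin> \<rho>"
  by (cases "v \<in> \<rho>") (auto simp: is_face_def insert_absorb insert_Diff_if)

lemma link_iff: "v \<in> link X S \<rho> \<longleftrightarrow> v \<notin> \<rho> \<and> insert v \<rho> \<in> S"
  using simplex_subset by (auto simp: link_def is_face_insert)

lemma cofaces_eq: "cofaces S \<rho> = (\<lambda>v. insert v \<rho>) ` link X S \<rho>"
  by (auto simp: cofaces_def is_face_iff link_iff)

lemma inj_on_link: "inj_on (\<lambda>v. insert v \<rho>) (link X S \<rho>)"
  by (auto simp: inj_on_def link_iff)

lemma summable_on_cofaces: "f summable_on cofaces S \<rho> \<longleftrightarrow> (\<lambda>v. f (insert v \<rho>)) summable_on link X S \<rho>"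
  unfolding cofaces_eq by (simp add: summable_on_reindex[OF inj_on_link] comp_def)

lemma infsum_cofaces: "infsum f (cofaces S \<rho>) = (\<Sum>\<^sub>\<infinity>v\<in>link X S \<rho>. f (insert v \<rho>))"
  unfolding cofaces_eq by (simp add: infsum_reindex[OF inj_on_link] comp_def)

lemma link_insert: "v' \<in> link X S (insert v \<rho>) \<longleftrightarrow> v' \<noteq> v \<and> insert v (insert v' \<rho>) \<in> S \<and> v' \<in> link X S \<rho>"
  using subsimplex[of "insert v (insert v' \<rho>)" "insert v' \<rho>"]
  by (auto simp: link_iff insert_commute)

lemma theta_pm: "\<sigma> \<in> S \<Longrightarrow> \<tau> \<in> S \<Longrightarrow> is_face \<tau> \<sigma> \<Longrightarrow> \<theta> \<tau> \<sigma> = 1 \<or> \<theta> \<tau> \<sigma> = -1"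
  using coeffs unfolding coboundary_coeffs_def faces_def by blast

lemma theta_link:
  assumes "\<rho> \<in> S" "v \<in> link X S \<rho>"
  shows "\<theta> \<rho> (insert v \<rho>) = 1 \<or> \<theta> \<rho> (insert v \<rho>) = -1"
  using theta_pm[of "insert v \<rho>" \<rho>] assms by (auto simp: link_iff is_face_iff)

lemma theta_link2:
  assumes "v \<in> link X S \<rho>" "v' \<in> link X S \<rho>" "v \<noteq> v'" "insert v (insert v' \<rho>) \<in> S"
  shows "\<theta> (insert v \<rho>) (insert v (insert v' \<rho>)) = 1 \<or> \<theta> (insert v \<rho>) (insert v (insert v' \<rho>)) = -1"
  by (rule theta_pm) (use assms in \<open>auto simp: link_iff is_face_iff insert_commute intro!: exI[of _ v']\<close>)

text \<open>
  Apply \<open>\<delta>\<delta> = 0\<close> to the indicator of \<open>\<rho>\<close>: precisely two simplices lie strictly between \<open>\<rho>\<close> and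
  \<open>vv'\<rho>\<close>, namely \<open>v\<rho>\<close> and \<open>v'\<rho>\<close>.
\<close>

lemma theta_anticommute:
  assumes \<rho>: "\<rho> \<in> S" and v: "v \<in> link X S \<rho>" "v' \<in> link X S \<rho>" "v \<noteq> v'"
    and \<sigma>: "insert v (insert v' \<rho>) \<in> S" (is "?\<sigma> \<in> S")
  shows "\<theta> \<rho> (insert v' \<rho>) * \<theta> (insert v' \<rho>) ?\<sigma> = - (\<theta> \<rho> (insert v \<rho>) * \<theta> (insert v \<rho>) ?\<sigma>)"
proof -
  let ?\<omega> = "\<lambda>\<tau>. if \<tau> = \<rho> then 1 else 0 :: complex"
  have fin: "finite (faces S \<sigma>)" if "\<sigma> \<in> S" for \<sigma>
    by (rule finite_subset[of _ "Pow \<sigma>"]) (use simplex_finite[OF that] in \<open>auto simp: faces_def is_face_def\<close>)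
  have d: "coboundary S \<theta> ?\<omega> \<tau> = (if is_face \<rho> \<tau> then \<theta> \<rho> \<tau> else 0)" if "\<tau> \<in> S" for \<tau>
  proof -
    have "coboundary S \<theta> ?\<omega> \<tau> = (\<Sum>\<kappa>\<in>faces S \<tau>. if \<kappa> = \<rho> then \<theta> \<kappa> \<tau> else 0)"
      unfolding coboundary_def by (rule sum.cong) auto
    also have "\<dots> = (if \<rho> \<in> faces S \<tau> then \<theta> \<rho> \<tau> else 0)" using fin[OF that] by simp
    finally show ?thesis using \<rho> by (simp add: faces_def)
  qed
  have "0 = coboundary S \<theta> (coboundary S \<theta> ?\<omega>) ?\<sigma>"
    using coeffs \<sigma> unfolding coboundary_coeffs_def by simp
  also have "\<dots> = (\<Sum>\<tau>\<in>faces S ?\<sigma>. \<theta> \<tau> ?\<sigma> * (if is_face \<rho> \<tau> then \<theta> \<rho> \<tau> else 0))"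
    unfolding coboundary_def[of S \<theta> "coboundary S \<theta> ?\<omega>"] by (rule sum.cong) (auto simp: d faces_def)
  also have "\<dots> = (\<Sum>\<tau>\<in>{insert v \<rho>, insert v' \<rho>}. \<theta> \<tau> ?\<sigma> * (if is_face \<rho> \<tau> then \<theta> \<rho> \<tau> else 0))"
  proof (rule sum.mono_neutral_right[OF fin[OF \<sigma>]])
    have "is_face (insert v \<rho>) ?\<sigma>" "is_face (insert v' \<rho>) ?\<sigma>"
      unfolding is_face_iff using v by (auto simp: link_iff intro: exI[of _ v] exI[of _ v'])
    then show "{insert v \<rho>, insert v' \<rho>} \<subseteq> faces S ?\<sigma>" using v by (auto simp: faces_def link_iff)
    have "\<tau> \<in> {insert v \<rho>, insert v' \<rho>}" if "\<tau> \<in> faces S ?\<sigma>" "is_face \<rho> \<tau>" for \<tau>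
    proof -
      obtain w where "w \<notin> \<rho>" "\<tau> = insert w \<rho>" using \<open>is_face \<rho> \<tau>\<close> by (auto simp: is_face_iff)
      moreover have "\<tau> \<subseteq> ?\<sigma>" using that(1) by (auto simp: faces_def is_face_def)
      ultimately show ?thesis by auto
    qed
    then show "\<forall>\<tau>\<in>faces S ?\<sigma> - {insert v \<rho>, insert v' \<rho>}. \<theta> \<tau> ?\<sigma> * (if is_face \<rho> \<tau> then \<theta> \<rho> \<tau> else 0) = 0"
      by auto
  qed
  also have "\<dots> = \<theta> (insert v \<rho>) ?\<sigma> * \<theta> \<rho> (insert v \<rho>) + \<theta> (insert v' \<rho>) ?\<sigma> * \<theta> \<rho> (insert v' \<rho>)"
  proof -
    have "is_face \<rho> (insert v \<rho>)" "is_face \<rho> (insert v' \<rho>)" using v by (auto simp: is_face_iff link_iff)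
    moreover have "insert v \<rho> \<noteq> insert v' \<rho>" using v by (auto simp: link_iff)
    ultimately show ?thesis by simp
  qed
  finally show ?thesis by (simp add: algebra_simps add_eq_0_iff)
qed

text \<open>
  The terms of \<open>\<partial>\<partial>\<omega>(\<rho>)\<close>, indexed by ordered pairs of vertices in the link. The weight is that of
  the link graph, so that pairs that do not span a simplex contribute 0.
\<close>

definition flow :: "('a set \<Rightarrow> complex) \<Rightarrow> 'a set \<Rightarrow> 'a \<Rightarrow> 'a \<Rightarrow> complex" where
  "flow \<omega> \<rho> v v' = of_real (link_graph S m \<rho> v v') *
     (\<theta> \<rho> (insert v \<rho>) * \<theta> (insert v \<rho>) (insert v (insert v' \<rho>)) * \<omega> (insert v (insert v' \<rho>)))"

lemma link_graph_sym: "link_graph S m \<rho> v v' = link_graph S m \<rho> v' v"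
  unfolding link_graph_def insert_commute[of v v'] by auto

lemma link_graph_nonneg: "link_graph S m \<rho> v v' \<ge> 0"
  using m_pos by (auto simp: link_graph_def less_imp_le)

lemma flow_antisym:
  assumes "\<rho> \<in> S" "v \<in> link X S \<rho>" "v' \<in> link X S \<rho>"
  shows "flow \<omega> \<rho> v' v = - flow \<omega> \<rho> v v'"
proof (cases "v \<noteq> v' \<and> insert v (insert v' \<rho>) \<in> S")
  case True
  then show ?thesis
    using theta_anticommute[of \<rho> v v'] assms
    by (simp add: flow_def link_graph_sym[of \<rho> v' v] insert_commute[of v' v])
qed (auto simp: flow_def link_graph_def insert_commute[of v v'])

text \<open>
  The divergence of the flow is the boundary of \<open>\<omega>\<close>, up to weight and sign. The link of \<open>v\<rho>\<close>
  consists of the neighbours of \<open>v\<close> in the link graph of \<open>\<rho>\<close>.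
\<close>

lemma boundary_link:
  assumes \<rho>: "\<rho> \<in> S" and v: "v \<in> link X S \<rho>"
  shows "of_real (m (insert v \<rho>)) * \<theta> \<rho> (insert v \<rho>) * boundary S m \<theta> \<omega> (insert v \<rho>) =
    (\<Sum>\<^sub>\<infinity>v'\<in>link X S \<rho>. flow \<omega> \<rho> v v')"
proof -
  let ?\<tau> = "insert v \<rho>"
  have "m ?\<tau> > 0" using v m_pos by (simp add: link_iff)
  then have "of_real (m ?\<tau>) * \<theta> \<rho> ?\<tau> * boundary S m \<theta> \<omega> ?\<tau> =
     \<theta> \<rho> ?\<tau> * (\<Sum>\<^sub>\<infinity>v'\<in>link X S ?\<tau>. of_real (m (insert v' ?\<tau>)) * \<theta> ?\<tau> (insert v' ?\<tau>) * \<omega> (insert v' ?\<tau>))"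
    by (simp add: boundary_def infsum_cofaces)
  also have "\<dots> = (\<Sum>\<^sub>\<infinity>v'\<in>link X S ?\<tau>. \<theta> \<rho> ?\<tau> * (of_real (m (insert v' ?\<tau>)) * \<theta> ?\<tau> (insert v' ?\<tau>) * \<omega> (insert v' ?\<tau>)))"
    by (rule infsum_cmult_right'[symmetric])
  also have "\<dots> = (\<Sum>\<^sub>\<infinity>v'\<in>link X S \<rho>. flow \<omega> \<rho> v v')"
    by (rule infsum_cong_neutral) (auto simp: link_insert flow_def link_graph_def insert_commute)
  finally show ?thesis .
qed

lemma boundary_boundary:
  assumes \<rho>: "\<rho> \<in> S"
  shows "boundary S m \<theta> (boundary S m \<theta> \<omega>) \<rho> =
    1 / of_real (m \<rho>) * (\<Sum>\<^sub>\<infinity>v\<in>link X S \<rho>. \<Sum>\<^sub>\<infinity>v'\<in>link X S \<rho>. flow \<omega> \<rho> v v')"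
proof -
  have "(\<Sum>\<^sub>\<infinity>v\<in>link X S \<rho>. of_real (m (insert v \<rho>)) * \<theta> \<rho> (insert v \<rho>) * boundary S m \<theta> \<omega> (insert v \<rho>)) =
    (\<Sum>\<^sub>\<infinity>v\<in>link X S \<rho>. \<Sum>\<^sub>\<infinity>v'\<in>link X S \<rho>. flow \<omega> \<rho> v v')"
    by (rule infsum_cong) (rule boundary_link[OF \<rho>])
  then show ?thesis by (simp add: boundary_def[of S m \<theta> "boundary S m \<theta> \<omega>"] infsum_cofaces)
qed

lemma link_graph_row_summable:
  assumes "v \<in> link X S \<rho>"
  shows "link_graph S m \<rho> v summable_on link X S \<rho>"
proof -
  have "insert v \<rho> \<in> S" using assms by (simp add: link_iff)
  from m_summable[OF this] have "(\<lambda>v'. m (insert v' (insert v \<rho>))) summable_on link X S (insert v \<rho>)"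
    by (simp add: summable_on_cofaces)
  also have "?this \<longleftrightarrow> ?thesis"
    by (rule summable_on_cong_neutral) (auto simp: link_insert link_graph_def insert_commute)
  finally show ?thesis .
qed

lemma countable_link: assumes "\<rho> \<in> S" shows "countable (link X S \<rho>)"
proof -
  have "countable {v \<in> link X S \<rho>. m (insert v \<rho>) \<noteq> 0}"
    using m_summable[OF assms] by (intro summable_countable_real) (simp add: summable_on_cofaces)
  also have "{v \<in> link X S \<rho>. m (insert v \<rho>) \<noteq> 0} = link X S \<rho>"
    using m_pos by (fastforce simp: link_iff)
  finally show ?thesis .
qed

lemma component_weighted_graph:
  assumes \<rho>: "\<rho> \<in> S" and C: "C \<in> connected_components_graph (link X S \<rho>) (link_graph S m \<rho>)"
  shows "weighted_graph C (link_graph S m \<rho>)"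
proof
  note comp = connected_component[OF _ C, OF link_graph_sym]
  show "link_graph S m \<rho> x summable_on C" if "x \<in> C" for x
    using summable_on_subset_banach[OF link_graph_row_summable comp(1)] comp(1) that by blast
  show "(x, y) \<in> {(x, y). x \<in> C \<and> y \<in> C \<and> 0 < link_graph S m \<rho> x y}\<^sup>*" if "x \<in> C" "y \<in> C" for x y
    using comp(4) that by blast
  show "countable C" using countable_subset[OF comp(1) countable_link[OF \<rho>]] .
qed (simp_all add: link_graph_nonneg link_graph_sym)

lemma infsum_components:
  fixes d :: "'a \<Rightarrow> complex"
  assumes d: "(\<lambda>v. norm (d v)) summable_on link X S \<rho>"
    and zero: "\<And>C. C \<in> connected_components_graph (link X S \<rho>) (link_graph S m \<rho>) \<Longrightarrow> infsum d C = 0"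
  shows "infsum d (link X S \<rho>) = 0"
proof -
  let ?Cs = "connected_components_graph (link X S \<rho>) (link_graph S m \<rho>)"
  let ?R = "{(x, y). x \<in> link X S \<rho> \<and> y \<in> link X S \<rho> \<and> link_graph S m \<rho> x y > 0}"
  note comp = connected_component[where b = "link_graph S m \<rho>" and V = "link X S \<rho>", OF link_graph_sym]
  have bij: "bij_betw snd (Sigma ?Cs (\<lambda>C. C)) (link X S \<rho>)"
    unfolding bij_betw_def
  proof
    show "inj_on snd (Sigma ?Cs (\<lambda>C. C))"
    proof (rule inj_onI)
      fix q q' assume q: "q \<in> Sigma ?Cs (\<lambda>C. C)" "q' \<in> Sigma ?Cs (\<lambda>C. C)" "snd q = snd q'"
      have "fst q = ?R\<^sup>* `` {snd q}" "fst q' = ?R\<^sup>* `` {snd q'}"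
        using q(1,2) by (auto intro!: comp(5))
      then show "q = q'" using q(3) by (simp add: prod_eq_iff)
    qed
    show "snd ` Sigma ?Cs (\<lambda>C. C) = link X S \<rho>"
    proof
      show "snd ` Sigma ?Cs (\<lambda>C. C) \<subseteq> link X S \<rho>" using comp(1) by fastforce
      show "link X S \<rho> \<subseteq> snd ` Sigma ?Cs (\<lambda>C. C)"
      proof
        fix v assume "v \<in> link X S \<rho>"
        then have "(?R\<^sup>* `` {v}, v) \<in> Sigma ?Cs (\<lambda>C. C)"
          unfolding connected_components_graph_def by (auto intro: quotientI)
        then show "v \<in> snd ` Sigma ?Cs (\<lambda>C. C)" by force
      qed
    qed
  qed
  have "(\<lambda>p. d (snd p)) summable_on Sigma ?Cs (\<lambda>C. C)"
    using abs_summable_summable[OF d] by (simp add: summable_on_reindex_bij_betw[OF bij])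
  then have "(\<Sum>\<^sub>\<infinity>p\<in>Sigma ?Cs (\<lambda>C. C). d (snd p)) = (\<Sum>\<^sub>\<infinity>C\<in>?Cs. infsum d C)"
    using infsum_Sigma'_banach[of "\<lambda>C v. d v" ?Cs "\<lambda>C. C"] by (simp add: case_prod_unfold)
  also have "\<dots> = 0" by (rule infsum_0) (rule zero)
  finally show ?thesis using infsum_reindex_bij_betw[OF bij, of d] by simp
qed

text \<open>
  The energy of the flow counts each simplex \<open>\<sigma> = vv'\<rho>\<close> twice, once for each choice of \<open>v\<close> in
  \<open>\<sigma> - \<rho>\<close>. The pairs \<open>(v, v')\<close> are therefore encoded as \<open>(\<sigma>, v)\<close>.
\<close>

lemma flow_energy_summable:
  assumes \<omega>: "\<omega> \<in> ell2 S m" and \<rho>: "\<rho> \<in> S"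
  shows "(\<lambda>(v, v'). (norm (flow \<omega> \<rho> v v'))\<^sup>2 / link_graph S m \<rho> v v') summable_on link X S \<rho> \<times> link X S \<rho>"
proof -
  let ?P = "{(v, v'). v \<in> link X S \<rho> \<and> v' \<in> link X S \<rho> \<and> v \<noteq> v' \<and> insert v (insert v' \<rho>) \<in> S}"
  let ?T = "{\<sigma> \<in> S. \<rho> \<subseteq> \<sigma> \<and> card (\<sigma> - \<rho>) = 2}"
  let ?w = "\<lambda>\<sigma>. m \<sigma> * (cmod (\<omega> \<sigma>))\<^sup>2"
  let ?h = "\<lambda>(v, v'). (insert v (insert v' \<rho>), v)"
  have "(\<lambda>q. ?w (fst q)) summable_on Sigma ?T (\<lambda>\<sigma>. \<sigma> - \<rho>)"
  proof (rule summable_on_SigmaI)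
    show "((\<lambda>v. ?w (fst (\<sigma>, v))) has_sum 2 * ?w \<sigma>) (\<sigma> - \<rho>)" if "\<sigma> \<in> ?T" for \<sigma>
      using that simplex_finite[of \<sigma>] by (intro has_sum_finiteI) auto
    show "(\<lambda>\<sigma>. 2 * ?w \<sigma>) summable_on ?T"
      using \<omega> by (intro summable_on_cmult_right) (auto simp: ell2_def elim: summable_on_subset_banach)
    show "0 \<le> ?w (fst (\<sigma>, v))" if "\<sigma> \<in> ?T" for \<sigma> v using m_pos[of \<sigma>] that by simp
  qed
  moreover have "?h ` ?P \<subseteq> Sigma ?T (\<lambda>\<sigma>. \<sigma> - \<rho>)"
  proof
    fix x assume "x \<in> ?h ` ?P"
    then obtain v v' where v: "v \<in> link X S \<rho>" "v' \<in> link X S \<rho>" "v \<noteq> v'" "insert v (insert v' \<rho>) \<in> S"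
      and x: "x = (insert v (insert v' \<rho>), v)" by auto
    have "insert v (insert v' \<rho>) - \<rho> = {v, v'}" using v by (auto simp: link_iff)
    then show "x \<in> Sigma ?T (\<lambda>\<sigma>. \<sigma> - \<rho>)" unfolding x using v by auto
  qed
  ultimately have "(\<lambda>q. ?w (fst q)) summable_on ?h ` ?P" by (rule summable_on_subset_banach)
  moreover have "inj_on ?h ?P"
  proof (rule inj_onI)
    fix q q' assume q: "q \<in> ?P" "q' \<in> ?P" "?h q = ?h q'"
    obtain v v' where v: "q = (v, v')" "v' \<in> link X S \<rho>" "v \<noteq> v'" using q(1) by auto
    obtain w' where w: "q' = (v, w')" "insert v (insert v' \<rho>) = insert v (insert w' \<rho>)"
      using q(3) v(1) by (cases q') auto
    have "v' \<in> insert v (insert w' \<rho>)" using w(2) by blast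
    then show "q = q'" using v w(1) by (auto simp: link_iff)
  qed
  ultimately have "((\<lambda>q. ?w (fst q)) \<circ> ?h) summable_on ?P" using summable_on_reindex by blast
  also have "?this \<longleftrightarrow> ?thesis"
  proof (rule summable_on_cong_neutral)
    fix q assume "q \<in> ?P \<inter> (link X S \<rho> \<times> link X S \<rho>)"
    then obtain v v' where q: "q = (v, v')" and v: "v \<in> link X S \<rho>" "v' \<in> link X S \<rho>" "v \<noteq> v'" "insert v (insert v' \<rho>) \<in> S"
      by auto
    have "norm (\<theta> \<rho> (insert v \<rho>)) = 1" using theta_link[OF \<rho> v(1)] by auto
    moreover have "norm (\<theta> (insert v \<rho>) (insert v (insert v' \<rho>))) = 1" using theta_link2[OF v] by auto
    ultimately have "norm (flow \<omega> \<rho> v v') = m (insert v (insert v' \<rho>)) * norm (\<omega> (insert v (insert v' \<rho>)))"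
      using v m_pos[OF v(4)] by (simp add: flow_def link_graph_def norm_mult)
    then show "((\<lambda>q. ?w (fst q)) \<circ> ?h) q = (case q of (v, v') \<Rightarrow> (norm (flow \<omega> \<rho> v v'))\<^sup>2 / link_graph S m \<rho> v v')"
      using v m_pos[OF v(4)] by (simp add: q link_graph_def power2_eq_square)
  qed (auto simp: flow_def link_graph_def split: if_splits)
  finally show ?thesis .
qed

text \<open>
  On each component of the link the flow has finite energy, and its divergence is summable since
  \<open>\<partial>\<omega>\<close> is square summable. So flow conservation applies component by component.
\<close>

lemma recurrent_imp_boundary_boundary_zero:
  assumes rec: "\<And>C. C \<in> connected_components_graph (link X S \<rho>) (link_graph S m \<rho>) \<Longrightarrow> recurrent_graph C (link_graph S m \<rho>)"
    and \<rho>: "\<rho> \<in> S" and \<omega>: "\<omega> \<in> boundaryN_dom S m \<theta>"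
  shows "boundary S m \<theta> (boundary S m \<theta> \<omega>) \<rho> = 0"
proof -
  let ?L = "link X S \<rho>" and ?b = "link_graph S m \<rho>"
  let ?d = "\<lambda>v. \<Sum>\<^sub>\<infinity>v'\<in>?L. flow \<omega> \<rho> v v'"
  have \<omega>2: "\<omega> \<in> ell2 S m" "boundary S m \<theta> \<omega> \<in> ell2 S m" using \<omega> by (auto simp: boundaryN_dom_def)
  have d_norm: "norm (?d v) = m (insert v \<rho>) * cmod (boundary S m \<theta> \<omega> (insert v \<rho>))" if v: "v \<in> ?L" for v
  proof -
    have "norm (\<theta> \<rho> (insert v \<rho>)) = 1" using theta_link[OF \<rho> v] by auto
    moreover have "m (insert v \<rho>) > 0" using v m_pos by (simp add: link_iff)
    ultimately show ?thesis by (simp add: boundary_link[OF \<rho> v, symmetric] norm_mult)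
  qed
  have "(\<lambda>\<tau>. m \<tau> * cmod (boundary S m \<theta> \<omega> \<tau>)) summable_on cofaces S \<rho>"
    using ell2_subset_boundary_dom[OF wsc] \<omega>2(2) \<rho> by (auto simp: boundary_dom_def S_def)
  then have d_sum: "(\<lambda>v. norm (?d v)) summable_on ?L"
    unfolding summable_on_cofaces by (rule summable_on_cong[THEN iffD1, rotated]) (simp add: d_norm)
  have "infsum ?d ?L = 0"
  proof (rule infsum_components[OF d_sum])
    fix C assume C: "C \<in> connected_components_graph ?L ?b"
    note comp = connected_component[where b = "link_graph S m \<rho>" and V = "link X S \<rho>", OF link_graph_sym C]
    have d_C: "?d v = (\<Sum>\<^sub>\<infinity>v'\<in>C. flow \<omega> \<rho> v v')" if v: "v \<in> C" for v
    proof (rule infsum_cong_neutral)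
      fix v' assume "v' \<in> ?L - C"
      then have "\<not> ?b v v' > 0" using comp(3)[OF v] by blast
      then have "?b v v' = 0" using link_graph_nonneg[of \<rho> v v'] by linarith
      then show "flow \<omega> \<rho> v v' = 0" by (simp add: flow_def)
    qed (use comp(1) in auto)
    show "infsum ?d C = 0"
    proof (cases "\<exists>v. C = {v}")
      case True
      then obtain v where "C = {v}" by blast
      then have "infsum ?d C = (\<Sum>\<^sub>\<infinity>v'\<in>C. flow \<omega> \<rho> v v')" using d_C[of v] by simp
      also have "\<dots> = 0" using \<open>C = {v}\<close> by (simp add: flow_def link_graph_def)
      finally show ?thesis .
    next
      case False
      interpret weighted_graph C ?b by (rule component_weighted_graph[OF \<rho> C])
      interpret nontrivial_graph C ?b
    by (rule nontrivial_graph.intro[OF weighted_graph_axioms nontrivial_graph_axioms.intro]) (rule False)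
      obtain q where q: "q \<in> C" using comp(2) by blast
      have cap: "capacity q = 0" using rec[OF C] q recurrent_iff_capacity_zero by blast
      have "infsum ?d C = (\<Sum>\<^sub>\<infinity>v\<in>C. \<Sum>\<^sub>\<infinity>v'\<in>C. flow \<omega> \<rho> v v')" by (rule infsum_cong) (rule d_C)
      also have "\<dots> = 0"
      proof (rule finite_energy_flow_conserved[OF q cap])
        show "flow \<omega> \<rho> y x = - flow \<omega> \<rho> x y" if "x \<in> C" "y \<in> C" for x y
          using flow_antisym[OF \<rho>] that comp(1) by blast
        show "flow \<omega> \<rho> x y = 0" if "?b x y = 0" for x y using that by (simp add: flow_def)
        show "(\<lambda>(x, y). (cmod (flow \<omega> \<rho> x y))\<^sup>2 / ?b x y) summable_on C \<times> C"
          by (rule summable_on_subset_banach[OF flow_energy_summable[OF \<omega>2(1) \<rho>]]) (use comp(1) in auto)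
        have "(\<lambda>v. norm (?d v)) summable_on C" using d_sum comp(1) by (rule summable_on_subset_banach)
        then show "(\<lambda>x. norm (\<Sum>\<^sub>\<infinity>y\<in>C. flow \<omega> \<rho> x y)) summable_on C"
          by (rule summable_on_cong[THEN iffD1, rotated]) (simp add: d_C)
      qed
      finally show ?thesis .
    qed
  qed
  then show ?thesis by (simp add: boundary_boundary[OF \<rho>])
qed


text \<open>
  Up to the cutoff to simplices of the form \<open>vv'\<rho>\<close>, this is the coboundary of the function that
  takes the value \<open>\<theta>(\<rho>,v\<rho>) u(v)\<close> at \<open>v\<rho>\<close>. Summing over both vertices of \<open>\<sigma> - \<rho>\<close> avoids choosing
  an order of them; the signs turn the sum into \<open>\<plusminus>(u(v) - u(v'))\<close>.
\<close>

definition gradient_chain :: "('a \<Rightarrow> real) \<Rightarrow> 'a set \<Rightarrow> 'a set \<Rightarrow> complex" where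
  "gradient_chain u \<rho> \<sigma> = (if \<rho> \<subseteq> \<sigma> \<and> card (\<sigma> - \<rho>) = 2
     then \<Sum>v\<in>\<sigma> - \<rho>. \<theta> \<rho> (insert v \<rho>) * \<theta> (insert v \<rho>) \<sigma> * of_real (u v) else 0)"

lemma gradient_chain_link:
  assumes \<rho>: "\<rho> \<in> S" and v: "v \<in> link X S \<rho>" "v' \<in> link X S \<rho>" "v \<noteq> v'"
    and \<sigma>: "insert v (insert v' \<rho>) \<in> S" (is "?\<sigma> \<in> S")
  shows "gradient_chain u \<rho> ?\<sigma> = \<theta> \<rho> (insert v \<rho>) * \<theta> (insert v \<rho>) ?\<sigma> * of_real (u v - u v')"
proof -
  have diff: "?\<sigma> - \<rho> = {v, v'}" using v by (auto simp: link_iff)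
  have "\<rho> \<subseteq> ?\<sigma>" by auto
  then show ?thesis
    unfolding gradient_chain_def diff using v(3) theta_anticommute[OF \<rho> v \<sigma>]
    by (simp add: algebra_simps)
qed

lemma gradient_chain_norm:
  assumes "\<rho> \<in> S" "v \<in> link X S \<rho>" "v' \<in> link X S \<rho>" "v \<noteq> v'" "insert v (insert v' \<rho>) \<in> S"
  shows "cmod (gradient_chain u \<rho> (insert v (insert v' \<rho>))) = \<bar>u v - u v'\<bar>"
proof -
  have "norm (\<theta> \<rho> (insert v \<rho>)) = 1" using theta_link[OF assms(1,2)] by auto
  moreover have "norm (\<theta> (insert v \<rho>) (insert v (insert v' \<rho>))) = 1" using theta_link2[OF assms(2-5)] by auto
  ultimately show ?thesis unfolding gradient_chain_link[OF assms] norm_mult norm_of_real by simp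
qed

lemma flow_gradient_chain:
  assumes \<rho>: "\<rho> \<in> S" and v: "v \<in> link X S \<rho>" "v' \<in> link X S \<rho>"
  shows "flow (gradient_chain u \<rho>) \<rho> v v' = of_real (link_graph S m \<rho> v v' * (u v - u v'))"
proof (cases "v \<noteq> v' \<and> insert v (insert v' \<rho>) \<in> S")
  case True
  let ?e = "\<theta> \<rho> (insert v \<rho>) * \<theta> (insert v \<rho>) (insert v (insert v' \<rho>))"
  have sq: "?e * ?e = 1" using theta_link[OF \<rho> v(1)] theta_link2[OF v] True by auto
  have "?e * (?e * of_real (u v - u v')) = of_real (u v - u v')"
    unfolding mult.assoc[of ?e ?e, symmetric] sq by simp
  moreover have "gradient_chain u \<rho> (insert v (insert v' \<rho>)) = ?e * of_real (u v - u v')"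
    using gradient_chain_link[OF \<rho> v] True by blast
  ultimately show ?thesis unfolding flow_def of_real_mult by presburger
qed (auto simp: flow_def link_graph_def)

lemma gradient_chain_support:
  assumes \<sigma>: "\<sigma> \<in> S" "gradient_chain u \<rho> \<sigma> \<noteq> 0" and \<rho>: "\<rho> \<in> S"
  shows "\<exists>v v'. v \<in> link X S \<rho> \<and> v' \<in> link X S \<rho> \<and> v \<noteq> v' \<and> \<sigma> = insert v (insert v' \<rho>)"
proof -
  have sub: "\<rho> \<subseteq> \<sigma>" and "card (\<sigma> - \<rho>) = 2" using \<sigma>(2) by (auto simp: gradient_chain_def split: if_splits)
  then obtain v v' where v: "\<sigma> - \<rho> = {v, v'}" "v \<noteq> v'" by (auto simp: card_2_iff)
  then have eq: "\<sigma> = insert v (insert v' \<rho>)" "v \<notin> \<rho>" "v' \<notin> \<rho>" using sub by auto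
  have l: "v \<in> link X S \<rho>" "v' \<in> link X S \<rho>"
    using subsimplex[OF \<sigma>(1), of "insert v \<rho>"] subsimplex[OF \<sigma>(1), of "insert v' \<rho>"] eq by (auto simp: link_iff)
  then show ?thesis using v(2) eq(1) by blast
qed

lemma gradient_chain_ell2:
  assumes \<rho>: "\<rho> \<in> S"
    and fin: "(\<lambda>(v, v'). link_graph S m \<rho> v v' * (u v - u v')\<^sup>2) summable_on link X S \<rho> \<times> link X S \<rho>"
  shows "gradient_chain u \<rho> \<in> ell2 S m"
proof -
  let ?P = "{(v, v'). v \<in> link X S \<rho> \<and> v' \<in> link X S \<rho> \<and> v \<noteq> v' \<and> insert v (insert v' \<rho>) \<in> S}"
  let ?h = "\<lambda>(v, v'). insert v (insert v' \<rho>)"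
  let ?w = "\<lambda>\<sigma>. m \<sigma> * (cmod (gradient_chain u \<rho> \<sigma>))\<^sup>2"
  have "(\<lambda>(v, v'). link_graph S m \<rho> v v' * (u v - u v')\<^sup>2) summable_on ?P"
    using fin by (rule summable_on_subset_banach) auto
  then have "(\<lambda>q. ?w (?h q)) summable_on ?P"
  proof (rule summable_on_cong[THEN iffD1, rotated])
    fix q assume "q \<in> ?P"
    then obtain v v' where q: "q = (v, v')" "v \<in> link X S \<rho>" "v' \<in> link X S \<rho>" "v \<noteq> v'" "insert v (insert v' \<rho>) \<in> S"
      by auto
    then show "(case q of (v, v') \<Rightarrow> link_graph S m \<rho> v v' * (u v - u v')\<^sup>2) = ?w (?h q)"
      using gradient_chain_norm[OF \<rho> q(2-5), of u] by (simp add: link_graph_def)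
  qed
  then have "?w summable_on ?h ` ?P" by (rule summable_on_image)
  also have "?this \<longleftrightarrow> ?w summable_on S"
  proof (rule summable_on_cong_neutral)
    fix \<sigma> assume \<sigma>: "\<sigma> \<in> S - ?h ` ?P"
    have "gradient_chain u \<rho> \<sigma> = 0"
    proof (rule ccontr)
      assume "gradient_chain u \<rho> \<sigma> \<noteq> 0"
      then obtain v v' where "v \<in> link X S \<rho>" "v' \<in> link X S \<rho>" "v \<noteq> v'" "\<sigma> = insert v (insert v' \<rho>)"
        using gradient_chain_support[OF _ _ \<rho>, of \<sigma> u] \<sigma> by blast
      then have "(v, v') \<in> ?P" "\<sigma> = ?h (v, v')" using \<sigma> by auto
      then show False using \<sigma> by blast
    qed
    then show "?w \<sigma> = 0" by simp
  qed auto
  finally show ?thesis by (simp add: ell2_def)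
qed

lemma remove_vertex_simplex:
  assumes "\<sigma> \<in> S" "\<rho> \<subseteq> \<sigma>" "card (\<sigma> - \<rho>) = 2" "w \<in> \<rho>"
  shows "\<sigma> - {w} \<in> S"
proof (rule subsimplex[OF assms(1) Diff_subset])
  show "\<sigma> - {w} \<noteq> {}"
  proof
    assume "\<sigma> - {w} = {}"
    then have "\<sigma> - \<rho> = {}" using assms(4) by auto
    then show False using assms(3) by (metis card.empty zero_neq_numeral)
  qed
qed

text \<open>
  The face that omits a vertex of \<open>\<rho>\<close> has a single coface in the support: a simplex that contains
  both the face and \<open>\<rho>\<close> contains \<open>\<sigma>\<close>. Hence no cancellation and no summation occur.
\<close>

lemma norm_boundary_gradient_chain:
  assumes \<rho>: "\<rho> \<in> S" and \<sigma>: "\<sigma> \<in> S" "\<rho> \<subseteq> \<sigma>" "card (\<sigma> - \<rho>) = 2" and w: "w \<in> \<rho>"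
  shows "m (\<sigma> - {w}) * (cmod (boundary S m \<theta> (gradient_chain u \<rho>) (\<sigma> - {w})))\<^sup>2
    = m \<sigma> / m (\<sigma> - {w}) * (m \<sigma> * (cmod (gradient_chain u \<rho> \<sigma>))\<^sup>2)"
proof -
  let ?\<tau> = "\<sigma> - {w}" and ?\<omega> = "gradient_chain u \<rho>"
  have face: "is_face ?\<tau> \<sigma>" unfolding is_face_iff using w \<sigma>(2) by (auto intro: exI[of _ w])
  have \<tau>: "?\<tau> \<in> S" by (rule remove_vertex_simplex[OF \<sigma> w])
  have uniq: "?\<omega> \<sigma>' = 0" if \<sigma>': "\<sigma>' \<in> cofaces S ?\<tau>" "\<sigma>' \<noteq> \<sigma>" for \<sigma>'
  proof (rule ccontr)
    assume "?\<omega> \<sigma>' \<noteq> 0"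
    then have "\<rho> \<subseteq> \<sigma>'" by (auto simp: gradient_chain_def split: if_splits)
    moreover obtain z where z: "\<sigma>' = insert z ?\<tau>" using \<sigma>'(1) by (auto simp: cofaces_def is_face_iff)
    ultimately have "z = w" using w by blast
    then have "\<sigma>' = \<sigma>" unfolding z using w \<sigma>(2) by blast
    with \<sigma>'(2) show False by blast
  qed
  have "(\<Sum>\<^sub>\<infinity>\<sigma>'\<in>cofaces S ?\<tau>. of_real (m \<sigma>') * \<theta> ?\<tau> \<sigma>' * ?\<omega> \<sigma>') = (\<Sum>\<^sub>\<infinity>\<sigma>'\<in>{\<sigma>}. of_real (m \<sigma>') * \<theta> ?\<tau> \<sigma>' * ?\<omega> \<sigma>')"
    by (rule infsum_cong_neutral) (use uniq face \<sigma>(1) in \<open>auto simp: cofaces_def\<close>)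
  then have "boundary S m \<theta> ?\<omega> ?\<tau> = 1 / of_real (m ?\<tau>) * (of_real (m \<sigma>) * \<theta> ?\<tau> \<sigma> * ?\<omega> \<sigma>)"
    by (simp add: boundary_def)
  moreover have "norm (\<theta> ?\<tau> \<sigma>) = 1" using theta_pm[OF \<sigma>(1) \<tau> face] by auto
  ultimately have eq: "cmod (boundary S m \<theta> ?\<omega> ?\<tau>) = m \<sigma> / m ?\<tau> * cmod (?\<omega> \<sigma>)"
    using m_pos[OF \<tau>] m_pos[OF \<sigma>(1)] by (simp add: norm_mult norm_divide)
  show ?thesis unfolding eq using m_pos[OF \<tau>] by (simp add: field_simps power2_eq_square)
qed

text \<open>
  The support of the boundary consists of simplices \<open>v\<rho>\<close>, finitely many by assumption, and of faces of
  simplices in the support that omit a vertex of \<open>\<rho>\<close>. On the latter, local balancedness bounds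
  the quotient of weights in \<open>norm_boundary_gradient_chain\<close> by a constant, and each simplex has only \<open>card \<rho>\<close> such faces.
\<close>

lemma boundary_gradient_chain_ell2:
  assumes bal: "locally_balanced X S m" and \<rho>: "\<rho> \<in> S"
    and \<omega>: "gradient_chain u \<rho> \<in> ell2 S m"
    and fin: "finite {v \<in> link X S \<rho>. boundary S m \<theta> (gradient_chain u \<rho>) (insert v \<rho>) \<noteq> 0}"
  shows "boundary S m \<theta> (gradient_chain u \<rho>) \<in> ell2 S m"
proof -
  let ?\<omega> = "gradient_chain u \<rho>"
  let ?f = "\<lambda>\<tau>. m \<tau> * (cmod (boundary S m \<theta> ?\<omega> \<tau>))\<^sup>2"
  let ?w = "\<lambda>\<sigma>. m \<sigma> * (cmod (?\<omega> \<sigma>))\<^sup>2"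
  let ?T = "{\<sigma> \<in> S. ?\<omega> \<sigma> \<noteq> 0}"
  let ?h = "\<lambda>(\<sigma>, w). \<sigma> - {w}"
  let ?A = "(\<lambda>v. insert v \<rho>) ` {v \<in> link X S \<rho>. boundary S m \<theta> ?\<omega> (insert v \<rho>) \<noteq> 0}"
  let ?B = "?h ` (?T \<times> \<rho>)"
  have T: "\<sigma> \<in> S" "\<rho> \<subseteq> \<sigma>" "card (\<sigma> - \<rho>) = 2" if "\<sigma> \<in> ?T" for \<sigma>
    using that by (auto simp: gradient_chain_def split: if_splits)
  obtain D where D: "\<And>x. x \<in> {m (insert v (insert v' \<rho>)) / m (insert v (insert v' \<rho>) - {w}) | v v' w.
           v \<in> link X S \<rho> \<and> v' \<in> link X S \<rho> \<and> v \<noteq> v' \<and>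
           insert v (insert v' \<rho>) \<in> S \<and> w \<in> \<rho>} \<Longrightarrow> x \<le> D"
    using bal \<rho> unfolding locally_balanced_def bdd_above_def by blast
  have "(\<lambda>q. ?f (?h q)) summable_on ?T \<times> \<rho>"
  proof (rule summable_on_comparison_test)
    show "(\<lambda>q. D * ?w (fst q)) summable_on ?T \<times> \<rho>"
    proof (rule summable_on_SigmaI[where g = "\<lambda>\<sigma>. real (card \<rho>) * (D * ?w \<sigma>)"])
      show "((\<lambda>w. D * ?w (fst (\<sigma>, w))) has_sum real (card \<rho>) * (D * ?w \<sigma>)) \<rho>" for \<sigma>
        using simplex_finite[OF \<rho>] by (intro has_sum_finiteI) auto
      show "(\<lambda>\<sigma>. real (card \<rho>) * (D * ?w \<sigma>)) summable_on ?T"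
        using \<omega> by (intro summable_on_cmult_right) (auto simp: ell2_def elim: summable_on_subset_banach)
    next
      fix \<sigma> w assume \<sigma>: "\<sigma> \<in> ?T" "w \<in> \<rho>"
      obtain v v' where v: "v \<in> link X S \<rho>" "v' \<in> link X S \<rho>" "v \<noteq> v'" "\<sigma> = insert v (insert v' \<rho>)"
        using gradient_chain_support[OF _ _ \<rho>, of \<sigma> u] \<sigma>(1) by blast
      have "\<sigma> - {w} \<in> S" by (rule remove_vertex_simplex[OF T[OF \<sigma>(1)] \<sigma>(2)])
      then have "0 \<le> m \<sigma> / m (\<sigma> - {w})" using m_pos T(1)[OF \<sigma>(1)] by (simp add: less_imp_le)
      also have "m \<sigma> / m (\<sigma> - {w}) \<le> D" by (rule D) (use v \<sigma> in blast)
      finally show "0 \<le> D * ?w (fst (\<sigma>, w))" using m_pos[OF T(1)[OF \<sigma>(1)]] by simp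
    qed
  next
    fix q assume "q \<in> ?T \<times> \<rho>"
    then obtain \<sigma> w where q: "q = (\<sigma>, w)" and \<sigma>: "\<sigma> \<in> ?T" "w \<in> \<rho>" by auto
    obtain v v' where v: "v \<in> link X S \<rho>" "v' \<in> link X S \<rho>" "v \<noteq> v'" "\<sigma> = insert v (insert v' \<rho>)"
      using gradient_chain_support[OF _ _ \<rho>, of \<sigma> u] \<sigma>(1) by blast
    have "m \<sigma> / m (\<sigma> - {w}) \<le> D" by (rule D) (use v \<sigma> in blast)
    then have "m \<sigma> / m (\<sigma> - {w}) * ?w \<sigma> \<le> D * ?w \<sigma>"
      using m_pos[OF T(1)[OF \<sigma>(1)]] by (intro mult_right_mono) auto
    then show "?f (?h q) \<le> D * ?w (fst q)"
      unfolding q prod.case fst_conv norm_boundary_gradient_chain[OF \<rho> T[OF \<sigma>(1)] \<sigma>(2)] .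
    have "\<sigma> - {w} \<in> S" by (rule remove_vertex_simplex[OF T[OF \<sigma>(1)] \<sigma>(2)])
    then show "0 \<le> ?f (?h q)" using m_pos unfolding q by (simp add: less_imp_le)
  qed
  then have "?f summable_on ?B" by (rule summable_on_image)
  moreover have "?f summable_on ?A" using fin by (intro summable_on_finite finite_imageI)
  ultimately have "?f summable_on ?B \<union> ?A" by (rule summable_on_union)
  also have "?this \<longleftrightarrow> ?f summable_on S"
  proof (rule summable_on_cong_neutral)
    fix \<tau> assume \<tau>: "\<tau> \<in> S - (?B \<union> ?A)"
    have "boundary S m \<theta> ?\<omega> \<tau> = 0"
    proof (rule ccontr)
      assume nz: "boundary S m \<theta> ?\<omega> \<tau> \<noteq> 0"
      have "\<exists>\<sigma>\<in>cofaces S \<tau>. ?\<omega> \<sigma> \<noteq> 0"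
      proof (rule ccontr)
        assume "\<not> ?thesis"
        then have "(\<Sum>\<^sub>\<infinity>\<sigma>\<in>cofaces S \<tau>. of_real (m \<sigma>) * \<theta> \<tau> \<sigma> * ?\<omega> \<sigma>) = 0" by (intro infsum_0) auto
        then show False using nz by (simp add: boundary_def)
      qed
      then obtain \<sigma> where "\<sigma> \<in> cofaces S \<tau>" and nz\<sigma>: "?\<omega> \<sigma> \<noteq> 0" by blast
      then obtain w where \<sigma>: "\<sigma> \<in> S" "w \<notin> \<tau>" "\<sigma> = insert w \<tau>" by (auto simp: cofaces_def is_face_iff)
      obtain v v' where v: "v \<in> link X S \<rho>" "v' \<in> link X S \<rho>" "v \<noteq> v'" "\<sigma> = insert v (insert v' \<rho>)"
        using gradient_chain_support[OF \<sigma>(1) nz\<sigma> \<rho>] by blast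
      have \<tau>_eq: "\<tau> = \<sigma> - {w}" using \<sigma>(2,3) by auto
      show False
      proof (cases "w \<in> \<rho>")
        case True
        then have "\<tau> \<in> ?B" using \<sigma>(1) nz\<sigma> \<tau>_eq by (intro image_eqI[of _ _ "(\<sigma>, w)"]) auto
        then show False using \<tau> by blast
      next
        case False
        then have "w = v \<or> w = v'" using \<sigma>(3) v(4) by auto
        then obtain z where z: "z \<in> link X S \<rho>" "\<tau> = insert z \<rho>"
          using \<tau>_eq v by (auto simp: link_iff)
        then have "\<tau> \<in> ?A" using nz by blast
        then show False using \<tau> by blast
      qed
    qed
    then show "?f \<tau> = 0" by simp
  next
    fix \<tau> assume "\<tau> \<in> ?B \<union> ?A - S"
    then have False
    proof (elim DiffE UnE)
      assume "\<tau> \<in> ?A" "\<tau> \<notin> S" then show False by (auto simp: link_iff)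
    next
      assume "\<tau> \<in> ?B" and n: "\<tau> \<notin> S"
      then obtain \<sigma> w where \<sigma>: "\<sigma> \<in> S" "?\<omega> \<sigma> \<noteq> 0" "w \<in> \<rho>" "\<tau> = \<sigma> - {w}" by auto
      obtain v v' where "v \<in> link X S \<rho>" "\<sigma> = insert v (insert v' \<rho>)"
        using gradient_chain_support[OF \<sigma>(1,2) \<rho>] by blast
      then have "v \<in> \<sigma> - {w}" using \<sigma>(3) by (auto simp: link_iff)
      then show False using subsimplex[OF \<sigma>(1), of \<tau>] \<sigma>(4) n by auto
    qed
    then show "?f \<tau> = 0" by simp
  qed auto
  finally show ?thesis by (simp add: ell2_def)
qed

text \<open>
  If a vertex \<open>q\<close> of a component had positive capacity, its equilibrium potential, extended by zero,
  would give a flow of finite energy whose only divergence is half the capacity at \<open>q\<close>. The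
  corresponding function is in the domain of \<open>\<partial>\<^sub>N\<close> and is not annihilated by \<open>\<partial>\<partial>\<close> at \<open>\<rho>\<close>.
\<close>

lemma boundary_boundary_zero_imp_recurrent:
  assumes bal: "locally_balanced X S m" and \<rho>: "\<rho> \<in> S"
    and zero: "\<And>\<omega>. \<omega> \<in> boundaryN_dom S m \<theta> \<Longrightarrow> boundary S m \<theta> (boundary S m \<theta> \<omega>) \<rho> = 0"
    and C: "C \<in> connected_components_graph (link X S \<rho>) (link_graph S m \<rho>)"
  shows "recurrent_graph C (link_graph S m \<rho>)"
proof (cases "\<exists>v. C = {v}")
  case True
  then show ?thesis unfolding recurrent_graph_def by (rule disjI1)
next
  case False
  let ?L = "link X S \<rho>" and ?b = "link_graph S m \<rho>"
  note comp = connected_component[where b = ?b and V = ?L, OF link_graph_sym C]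
  interpret weighted_graph C ?b by (rule component_weighted_graph[OF \<rho> C])
  interpret nontrivial_graph C ?b
    by (rule nontrivial_graph.intro[OF weighted_graph_axioms nontrivial_graph_axioms.intro]) (rule False)
  have "capacity q = 0" if q: "q \<in> C" for q
  proof -
    obtain u where u_bd: "\<forall>x. 0 \<le> u x \<and> u x \<le> 1"
      and u_fin: "(\<lambda>(x, y). ?b x y * (u x - u y)\<^sup>2) summable_on C \<times> C"
      and u_lap: "\<forall>x\<in>C. laplacian u x = (if x = q then capacity q / 2 else 0)"
      using equilibrium_potential[OF q] by blast
    define u0 where "u0 v = (if v \<in> C then u v else 0)" for v
    let ?\<omega> = "gradient_chain u0 \<rho>"
    have cut: "?b v v' = 0" if "v \<in> ?L" "v' \<in> ?L" "(v \<in> C) \<noteq> (v' \<in> C)" for v v'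
    proof (rule ccontr)
      assume "?b v v' \<noteq> 0"
      then have "?b v v' > 0" "?b v' v > 0"
        using link_graph_nonneg[of \<rho> v v'] link_graph_sym[of \<rho> v v'] by auto
      then show False using comp(3) that by blast
    qed
    have "(\<lambda>(v, v'). ?b v v' * (u0 v - u0 v')\<^sup>2) summable_on ?L \<times> ?L"
    proof (rule summable_on_cong_neutral[THEN iffD1, OF _ _ _ u_fin])
      show "(case q of (v, v') \<Rightarrow> ?b v v' * (u0 v - u0 v')\<^sup>2) = 0" if "q \<in> ?L \<times> ?L - C \<times> C" for q
        using that cut[of "fst q" "snd q"] by (cases "fst q \<in> C"; cases "snd q \<in> C") (auto simp: u0_def)
    qed (use comp(1) in \<open>auto simp: u0_def\<close>)
    then have \<omega>: "?\<omega> \<in> ell2 S m" by (rule gradient_chain_ell2[OF \<rho>])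
    have div: "(\<Sum>\<^sub>\<infinity>v'\<in>?L. flow ?\<omega> \<rho> v v') = (if v = q then of_real (capacity q / 2) else 0)" if v: "v \<in> ?L" for v
    proof (cases "v \<in> C")
      case True
      have "(\<Sum>\<^sub>\<infinity>v'\<in>?L. flow ?\<omega> \<rho> v v') = (\<Sum>\<^sub>\<infinity>v'\<in>C. of_real (?b v v' * (u v - u v')))"
        by (rule infsum_cong_neutral)
           (use True v comp(1) cut in \<open>auto simp: flow_gradient_chain[OF \<rho>] u0_def\<close>)
      also have "\<dots> = of_real (laplacian u v)"
      proof -
        have "(\<lambda>v'. ?b v v' * (u v - u v')) summable_on C"
          by (rule abs_summable_summable, rule row_summable[OF _ True, of u 1]) (use u_bd in simp)
        then show ?thesis unfolding laplacian_def by (intro infsumI has_sum_of_real has_sum_infsum)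
      qed
      finally show ?thesis using u_lap True by simp
    next
      case False
      have "(\<Sum>\<^sub>\<infinity>v'\<in>?L. flow ?\<omega> \<rho> v v') = 0"
        by (rule infsum_0) (use False v cut in \<open>auto simp: flow_gradient_chain[OF \<rho>] u0_def\<close>)
      then show ?thesis using False q by auto
    qed
    have "boundary S m \<theta> ?\<omega> (insert v \<rho>) = 0" if "v \<in> ?L" "v \<noteq> q" for v
    proof -
      have "m (insert v \<rho>) > 0" "\<theta> \<rho> (insert v \<rho>) \<noteq> 0"
        using that m_pos theta_link[OF \<rho> that(1)] by (auto simp: link_iff)
      then show ?thesis using boundary_link[OF \<rho> that(1), of ?\<omega>] div[OF that(1)] that(2) by simp
    qed
    then have "{v \<in> ?L. boundary S m \<theta> ?\<omega> (insert v \<rho>) \<noteq> 0} \<subseteq> {q}" by auto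
    then have "finite {v \<in> ?L. boundary S m \<theta> ?\<omega> (insert v \<rho>) \<noteq> 0}" by (rule finite_subset) simp
    then have "?\<omega> \<in> boundaryN_dom S m \<theta>"
      using boundary_gradient_chain_ell2[OF bal \<rho> \<omega>] \<omega> by (simp add: boundaryN_dom_def)
    then have "(\<Sum>\<^sub>\<infinity>v\<in>?L. \<Sum>\<^sub>\<infinity>v'\<in>?L. flow ?\<omega> \<rho> v v') = 0"
      using zero[of ?\<omega>] m_pos[OF \<rho>] by (simp add: boundary_boundary[OF \<rho>])
    moreover have "(\<Sum>\<^sub>\<infinity>v\<in>?L. \<Sum>\<^sub>\<infinity>v'\<in>?L. flow ?\<omega> \<rho> v v') = (\<Sum>\<^sub>\<infinity>v\<in>{q}. of_real (capacity q / 2))"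
      by (rule infsum_cong_neutral) (use div comp(1) q in auto)
    ultimately show ?thesis by simp
  qed
  then show ?thesis using recurrent_iff_capacity_zero by blast
qed

end

theorem theorem4p2:
  fixes X :: "'a set" and K :: "'a set set" and m :: "'a set \<Rightarrow> real"
    and \<theta> :: "'a set \<Rightarrow> 'a set \<Rightarrow> complex" and S :: "'a set set"
  assumes "weighted_simplicial_complex X K m"
    and "S = simplices X K m"
    and "coboundary_coeffs S \<theta>"
    and "locally_balanced X S m"
  shows "(\<forall>\<omega>\<in>boundaryN_dom S m \<theta>. \<forall>\<rho>\<in>S. boundary S m \<theta> (boundary S m \<theta> \<omega>) \<rho> = 0)
    \<longleftrightarrow> (\<forall>\<rho>\<in>S. \<forall>C\<in>connected_components_graph (link X S \<rho>) (link_graph S m \<rho>).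
            recurrent_graph C (link_graph S m \<rho>))"
proof -
  interpret weighted_complex X K m \<theta> S by standard fact+
  show ?thesis
    using recurrent_imp_boundary_boundary_zero boundary_boundary_zero_imp_recurrent[OF assms(4)] by blast
qed

end
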